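(* Let $w_c$ be a closed web $w$ with a coloring $c$, let $u\in\mathbb{S}$ be a color different from green, and let $C$ be an $\mathbb{S}_u$-bi-colored cycle in $w_c$. Then $$d_t(w_{\tau_C(c)})=\begin{cases} d_t(w_c)-2 & \text{if } C \text{ (as a cycle of } w_c) \text{ is positively oriented},\\ d_t(w_c)+2 & \text{if } C \text{ is negatively oriented}.\end{cases}$$
   Context: A closed web is a finite 3-regular oriented multigraph, possibly with some vertex-less loops (oriented circles), smoothly embedded in $\mathbb{R}^2$, such that every vertex is either a sink or a source. Let $\mathbb{S}=\{\mathrm{red},\mathrm{green},\mathrm{blue}\}$ with the total order $\mathrm{red}<\mathrm{green}<\mathrm{blue}$. For $u\in\mathbb{S}$ let $\mathbb{S}_u=\mathbb{S}\setminus\{u\}$ with the induced order. An $\mathbb{S}_u$-colored cycle is either an oriented circle embedded in the plane and colored with one of the two colors of $\mathbb{S}_u$, or a connected plane oriented 2-regular graph whose vertices are all sinks or sources, with edges colored by $\mathbb{S}_u$ so that adjacent edges have different colors. It is positively oriented if, after reversing the orientation of the edges (or of the circle) colored with the greatest element of $\mathbb{S}_u$, the result is a counterclockwise oriented cycle. Otherwise it is negatively oriented. An $\mathbb{S}_u$-colored configuration $D$ is a finite disjoint union of $\mathbb{S}_u$-colored cycles. Its degree $d(D)$ is the number of its positively oriented cycles minus the number of its negatively oriented cycles. A coloring of a closed web $w$ is a function from the set of edges and vertex-less circles of $w$ to $\mathbb{S}$ such that adjacent edges get different colors. $w_c$ denotes $w$ together with a coloring $c$. For $u\in\mathbb{S}$,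 $D_u(w_c)$ is the $\mathbb{S}_u$-colored configuration obtained from $w_c$ by deleting all edges and circles of color $u$. An $\mathbb{S}_u$-bi-colored cycle in $w_c$ is a connected component of $D_u(w_c)$; it is an $\mathbb{S}_u$-colored cycle. The total degree of $w_c$ is $d_t(w_c)=\sum_{u\in\mathbb{S}}d(D_u(w_c))$. For an $\mathbb{S}_u$-bi-colored cycle $C$ in $w_c$, $\tau_C(c)$ is the coloring which agrees with $c$ outside $C$ and exchanges the two colors of $\mathbb{S}_u$ on $C$. *)

theory Defs
  imports "HOL-Complex_Analysis.Complex_Analysis" "Graph_Theory.Graph_Theory"
begin

datatype color = Red | Green | Blue

fun color_rank :: "color \<Rightarrow> nat" where
  "color_rank Red = 0"
| "color_rank Green = 1"
| "color_rank Blue = 2"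

instantiation color :: linorder
begin

definition less_eq_color :: "color \<Rightarrow> color \<Rightarrow> bool" where
  "a \<le> b \<longleftrightarrow> color_rank a \<le> color_rank b"

definition less_color :: "color \<Rightarrow> color \<Rightarrow> bool" where
  "a < b \<longleftrightarrow> color_rank a < color_rank b"

instance
proof
  fix x y :: color
  show "x \<le> y \<Longrightarrow> y \<le> x \<Longrightarrow> x = y"
    by (cases x; cases y) (auto simp: less_eq_color_def)
qed (auto simp: less_eq_color_def less_color_def)

end

instance color :: finite
proof
  have "(UNIV :: color set) = {Red, Green, Blue}"
    using color.exhaust by auto
  then show "finite (UNIV :: color set)"
    by (metis finite.emptyI finite.insertI)
qed

abbreviation colors_without :: "color \<Rightarrow> color set" where
  "colors_without u \<equiv> UNIV - {u}"

text \<open>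
  The plane is the complex plane, so that winding numbers are available.  Vertices are points of
  the plane.  The type \<open>'e\<close> names both the edges (the arcs of the digraph) and the vertex-less
  circles, which lie in the disjoint set \<open>circles\<close>; each of them is drawn by
  its curve, parametrized by \<open>{0..1}\<close> in the direction of its orientation.
\<close>

record 'e plane_graph =
  digraph_of :: "(complex, 'e) pre_digraph"
  circles :: "'e set"
  curve :: "'e \<Rightarrow> real \<Rightarrow> complex"

definition edges_and_circles :: "'e plane_graph \<Rightarrow> 'e set" where
  "edges_and_circles G = arcs (digraph_of G) \<union> circles G"

definition support :: "'e plane_graph \<Rightarrow> complex set" where
  "support G = verts (digraph_of G) \<union> (\<Union>e \<in> edges_and_circles G. path_image (curve G e))"

text \<open>
  \<open>D n\<close> is the \<open>n\<close>-th derivative, one-sided at the end points of the interval.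
  A smooth closed curve is one that is also smooth where it closes up.
\<close>

definition smooth_curve :: "(real \<Rightarrow> complex) \<Rightarrow> bool" where
  "smooth_curve g \<longleftrightarrow> (\<exists>D. D 0 = g \<and>
     (\<forall>n. \<forall>t \<in> {0..1}. (D n has_vector_derivative D (Suc n) t) (at t within {0..1})) \<and>
     (\<forall>t \<in> {0..1}. D 1 t \<noteq> 0))"

definition smooth_closed_curve :: "(real \<Rightarrow> complex) \<Rightarrow> bool" where
  "smooth_closed_curve g \<longleftrightarrow> (\<exists>D. D 0 = g \<and>
     (\<forall>n. \<forall>t \<in> {0..1}. (D n has_vector_derivative D (Suc n) t) (at t within {0..1})) \<and>
     (\<forall>t \<in> {0..1}. D 1 t \<noteq> 0) \<and>
     (\<forall>n. D n 0 = D n 1))"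

definition curve_interior :: "'e plane_graph \<Rightarrow> 'e \<Rightarrow> complex set" where
  "curve_interior G e =
     (if e \<in> circles G then path_image (curve G e) else curve G e ` {0<..<1})"

definition smoothly_embedded :: "'e plane_graph \<Rightarrow> bool" where
  "smoothly_embedded G \<longleftrightarrow>
     (\<forall>e \<in> arcs (digraph_of G).
        smooth_curve (curve G e) \<and> simple_path (curve G e) \<and>
        pathstart (curve G e) = tail (digraph_of G) e \<and>
        pathfinish (curve G e) = head (digraph_of G) e) \<and>
     (\<forall>l \<in> circles G. smooth_closed_curve (curve G l) \<and> simple_path (curve G l)) \<and>
     disjoint_family_on (curve_interior G) (edges_and_circles G) \<and>
     (\<forall>e \<in> edges_and_circles G. curve_interior G e \<inter> verts (digraph_of G) = {})"

definition closed_web :: "'e plane_graph \<Rightarrow> bool" where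
  "closed_web w \<longleftrightarrow>
     fin_digraph (digraph_of w) \<and> finite (circles w) \<and>
     arcs (digraph_of w) \<inter> circles w = {} \<and>
     smoothly_embedded w \<and>
     (\<forall>v \<in> verts (digraph_of w).
        in_degree (digraph_of w) v + out_degree (digraph_of w) v = 3 \<and>
        (in_arcs (digraph_of w) v = {} \<or> out_arcs (digraph_of w) v = {}))"

definition adjacent_edges :: "'e plane_graph \<Rightarrow> 'e \<Rightarrow> 'e \<Rightarrow> bool" where
  "adjacent_edges G e f \<longleftrightarrow>
     e \<in> arcs (digraph_of G) \<and> f \<in> arcs (digraph_of G) \<and> e \<noteq> f \<and>
     {tail (digraph_of G) e, head (digraph_of G) e} \<inter>
     {tail (digraph_of G) f, head (digraph_of G) f} \<noteq> {}"

text \<open>Only the values of \<open>c\<close> on the edges and circles of \<open>w\<close> are relevant.\<close>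

definition coloring :: "'e plane_graph \<Rightarrow> ('e \<Rightarrow> color) \<Rightarrow> bool" where
  "coloring w c \<longleftrightarrow> (\<forall>e f. adjacent_edges w e f \<longrightarrow> c e \<noteq> c f)"

definition configuration :: "color \<Rightarrow> 'e plane_graph \<Rightarrow> ('e \<Rightarrow> color) \<Rightarrow> 'e plane_graph" where
  "configuration u w c = w
     \<lparr> digraph_of := (digraph_of w) \<lparr> arcs := {e \<in> arcs (digraph_of w). c e \<noteq> u} \<rparr>,
       circles := {l \<in> circles w. c l \<noteq> u} \<rparr>"

definition restrict_to :: "'e plane_graph \<Rightarrow> complex set \<Rightarrow> 'e plane_graph" where
  "restrict_to G K = G
     \<lparr> digraph_of := (digraph_of G)
         \<lparr> verts := verts (digraph_of G) \<inter> K,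
           arcs := {e \<in> arcs (digraph_of G). path_image (curve G e) \<subseteq> K} \<rparr>,
       circles := {l \<in> circles G. path_image (curve G l) \<subseteq> K} \<rparr>"

text \<open>The connected components of a plane graph, seen as a subspace of the plane.\<close>

definition component_graphs :: "'e plane_graph \<Rightarrow> 'e plane_graph set" where
  "component_graphs G = restrict_to G ` components (support G)"

definition bicolored_cycles ::
  "color \<Rightarrow> 'e plane_graph \<Rightarrow> ('e \<Rightarrow> color) \<Rightarrow> 'e plane_graph set" where
  "bicolored_cycles u w c = component_graphs (configuration u w c)"

definition reverse_edges :: "'e set \<Rightarrow> 'e plane_graph \<Rightarrow> 'e plane_graph" where
  "reverse_edges R G = G
     \<lparr> digraph_of := (digraph_of G)
         \<lparr> tail := (\<lambda>e. if e \<in> R then head (digraph_of G) e else tail (digraph_of G) e),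
           head := (\<lambda>e. if e \<in> R then tail (digraph_of G) e else head (digraph_of G) e) \<rparr>,
       curve := (\<lambda>e. if e \<in> R then reversepath (curve G e) else curve G e) \<rparr>"

definition counterclockwise_curve :: "(real \<Rightarrow> complex) \<Rightarrow> bool" where
  "counterclockwise_curve g \<longleftrightarrow>
     simple_path g \<and> pathfinish g = pathstart g \<and>
     (\<forall>z \<in> inside (path_image g). winding_number g z = 1)"

fun join_curves :: "(real \<Rightarrow> complex) list \<Rightarrow> real \<Rightarrow> complex" where
  "join_curves [] = (\<lambda>t. 0)"
| "join_curves [g] = g"
| "join_curves (g # h # gs) = g +++ join_curves (h # gs)"

text \<open>
  A counterclockwise oriented cycle is either a single counterclockwise circle or a directed cycle
  through all edges whose concatenation is a counterclockwise curve.
\<close>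

definition counterclockwise_cycle :: "'e plane_graph \<Rightarrow> bool" where
  "counterclockwise_cycle G \<longleftrightarrow>
     (arcs (digraph_of G) = {} \<and>
        (\<exists>l. circles G = {l} \<and> counterclockwise_curve (curve G l))) \<or>
     (circles G = {} \<and>
        (\<exists>es. pre_digraph.cycle (digraph_of G) es \<and> set es = arcs (digraph_of G) \<and>
              counterclockwise_curve (join_curves (map (curve G) es))))"

definition positively_oriented :: "color \<Rightarrow> ('e \<Rightarrow> color) \<Rightarrow> 'e plane_graph \<Rightarrow> bool" where
  "positively_oriented u c C \<longleftrightarrow>
     counterclockwise_cycle (reverse_edges {e. c e = Max (colors_without u)} C)"

definition negatively_oriented :: "color \<Rightarrow> ('e \<Rightarrow> color) \<Rightarrow> 'e plane_graph \<Rightarrow> bool" where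
  "negatively_oriented u c C \<longleftrightarrow> \<not> positively_oriented u c C"

definition config_degree :: "color \<Rightarrow> ('e \<Rightarrow> color) \<Rightarrow> 'e plane_graph \<Rightarrow> int" where
  "config_degree u c D =
     int (card {C \<in> component_graphs D. positively_oriented u c C}) -
     int (card {C \<in> component_graphs D. negatively_oriented u c C})"

definition total_degree :: "'e plane_graph \<Rightarrow> ('e \<Rightarrow> color) \<Rightarrow> int" where
  "total_degree w c = (\<Sum>u \<in> UNIV. config_degree u c (configuration u w c))"

definition swap_colors ::
  "color \<Rightarrow> 'e plane_graph \<Rightarrow> ('e \<Rightarrow> color) \<Rightarrow> 'e \<Rightarrow> color" where
  "swap_colors u C c = (\<lambda>e.
     if e \<in> edges_and_circles C
     then Transposition.transpose (Min (colors_without u)) (Max (colors_without u)) (c e)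
     else c e)"

end

theory Submission
  imports Defs
begin

text \<open>
  The idea is to replace the degree of a cycle, which is global, by a sum of local terms.  For a simple
  closed curve \<open>g\<close> choose a continuous logarithm \<open>L\<close> of the secant \<open>g t - g s\<close>
  on the strip \<open>s < t < s + 1\<close>.  A topological form of Hopf's Umlaufsatz says that
  \<open>L\<close> increases by \<open>2 \<pi> \<i>\<close> times the winding number of \<open>g\<close> about its
  inside when both parameters run once around the curve.  If \<open>g\<close> is a cyclic concatenation of
  edges, the path in the strip can be chosen so that this increment is a sum of terms
  \<open>turn e f\<close>, one for each pair of consecutive edges and depending on these two edges only.  No
  tangent directions at the vertices are involved.

  Let \<open>u\<close> be different from green.  In the two configurations that keep the color \<open>u\<close> the
  edges are reversed according to one and the same rule, which only refers to the set of edges colored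
  \<open>u\<close>; and every pair of consecutive edges consists of an edge colored \<open>u\<close> and another
  one, so it occurs in exactly one of the two.  Hence the sum of their degrees depends on the edges and
  circles colored \<open>u\<close> only, and the exchange along \<open>C\<close> does not affect it.  In the third
  configuration the exchange reverses \<open>C\<close> and nothing else.
\<close>

section \<open>Logarithms along paths\<close>

text \<open>The exchange moves every edge of \<open>C\<close> from one of the other two
  configurations to the other. Their cycles are cut open and closed up differently, so there are no
  cycles to be matched; only a sum over places in the web that ignores how cycles continue can be
  carried over. Exterior angles would be the obvious summands, but the tangents at a vertex are
  arbitrary and two edges may form a cusp, where the angle has no definite sign. Secants avoid this.
  The restriction on \<open>u\<close> comes from the order of the colors. If \<open>u\<close> is
  \<open>Blue\<close>, both configurations keeping \<open>u\<close> reverse blue. If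
  \<open>u\<close> is \<open>Red\<close>, one reverses blue and the other green, which in each case
  means all that is not red. For \<open>Green\<close> one would reverse blue and the other green,
  and the directions of a green edge would disagree. At a vertex all three edges point the same way.
  After the reversal the edge colored \<open>u\<close> is opposed to the two others, which gives two
  consecutive pairs, one in each configuration. The number 2 is the difference between a sign and
  its negative.\<close>

lemma exp_eq_imp_constant_diff:
  fixes f g :: "'a::topological_space \<Rightarrow> complex"
  assumes S: "topological_space_class.connected S" and f: "continuous_on S f" and g: "continuous_on S g"
    and eq: "\<And>x. x \<in> S \<Longrightarrow> exp (f x) = k * exp (g x)"
    and x: "x \<in> S" and y: "y \<in> S"
  shows "f x - g x = f y - g y"
proof -
  have "(\<lambda>x. f x - g x) constant_on S"
  proof (rule continuous_discrete_range_constant [OF S])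
    show "continuous_on S (\<lambda>x. f x - g x)"
      by (intro continuous_intros f g)
    fix x assume "x \<in> S"
    \<comment> \<open>The exponential of \<open>f - g\<close> is constantly \<open>k\<close>, so two
      values differ by a multiple of \<open>2 * pi * \<i>\<close>; the range is discrete with gaps
      of at least \<open>2 * pi\<close>.\<close>
    show "\<exists>e>0. \<forall>y. y \<in> S \<and> f y - g y \<noteq> f x - g x \<longrightarrow> e \<le> norm ((f y - g y) - (f x - g x))"
    proof (intro exI [of _ "2 * pi"] conjI allI impI)
      fix y assume y: "y \<in> S \<and> f y - g y \<noteq> f x - g x"
      have *: "exp (f z - g z) = k" if "z \<in> S" for z
        using eq [OF that] by (simp add: exp_diff)
      then have "exp (f y - g y) = exp (f x - g x)"
        using y \<open>x \<in> S\<close> by metis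
      then obtain n :: int where n: "f y - g y = (f x - g x) + (of_int (2 * n) * pi) * \<i>"
        by (auto simp: exp_eq)
      then have "n \<noteq> 0" using y by auto
      then have "1 \<le> \<bar>real_of_int n\<bar>" by linarith
      then show "2 * pi \<le> norm ((f y - g y) - (f x - g x))"
        by (simp add: n norm_mult)
    qed auto
  qed
  then show ?thesis
    using x y unfolding constant_on_def by metis
qed

text \<open>The factor \<open>k\<close> admits secants taken in either direction: turning a secant
  around costs the factor -1, which does not affect the increment of a logarithm.\<close>

lemma winding_number_log_lift:
  assumes l: "continuous_on {0..1} l"
    and eq: "\<And>t. t \<in> {0..1} \<Longrightarrow> p t - \<zeta> = k * exp (l t)" and "k \<noteq> 0"
  shows "l 1 - l 0 = 2 * of_real pi * \<i> * winding_number p \<zeta>"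
proof -
  have "continuous_on {0..1} (\<lambda>t. \<zeta> + k * exp (l t))"
    by (intro continuous_intros l)
  then have p: "path p"
    unfolding path_def using eq by (subst continuous_on_cong [OF refl]) (auto simp: algebra_simps)
  have \<zeta>: "\<zeta> \<notin> path_image p"
    using eq \<open>k \<noteq> 0\<close> by (force simp: path_image_def)
  obtain q where q: "path q" "pathfinish q - pathstart q = 2 * of_real pi * \<i> * winding_number p \<zeta>"
    "\<And>t. t \<in> {0..1} \<Longrightarrow> p t = \<zeta> + exp (q t)"
    using winding_number_as_continuous_log [OF p \<zeta>] by blast
  have "q 1 - l 1 = q 0 - l 0"
  proof (rule exp_eq_imp_constant_diff [where S = "{0..1}" and k = k])
    show "exp (q t) = k * exp (l t)" if "t \<in> {0..1}" for t
      using q(3) [OF that] eq [OF that] by simp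
  qed (use q(1) l in \<open>auto simp: path_def\<close>)
  then show ?thesis
    using q(2) by (simp add: pathfinish_def pathstart_def algebra_simps)
qed

lemma winding_number_subpath_log_lift:
  assumes l: "continuous_on {u..v} l" and "u \<le> v"
    and eq: "\<And>t. t \<in> {u..v} \<Longrightarrow> p t - \<zeta> = k * exp (l t)" and "k \<noteq> 0"
  shows "l v - l u = 2 * of_real pi * \<i> * winding_number (subpath u v p) \<zeta>"
proof -
  have *: "(v - u) * t + u \<in> {u..v}" if "t \<in> {0..1}" for t
  proof -
    have "0 \<le> (v - u) * t" "(v - u) * t \<le> v - u"
      using that \<open>u \<le> v\<close> by (auto intro: mult_left_le)
    then show ?thesis by simp
  qed
  have "continuous_on {0..1} (\<lambda>t. l ((v - u) * t + u))"
    by (rule continuous_on_compose2 [OF l]) (use * in \<open>auto intro!: continuous_intros\<close>)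
  from winding_number_log_lift [OF this, of "subpath u v p" \<zeta> k] show ?thesis
    using eq * \<open>k \<noteq> 0\<close> by (auto simp: subpath_def)
qed

text \<open>Along a horizontal or vertical segment of the parameter plane one end of the secant
  rests, so the increment of the logarithm is a winding number of the piece traversed by the other
  end. The increments of secant logarithms below are put together from such segments.\<close>

lemma secant_log_fst:
  assumes L: "continuous_on P L"
    and eq: "\<And>s t. (s, t) \<in> P \<Longrightarrow> G t - G s = exp (L (s, t))"
    and "u \<le> v" and P: "{u..v} \<times> {t} \<subseteq> P"
  shows "L (v, t) - L (u, t) = 2 * of_real pi * \<i> * winding_number (subpath u v G) (G t)"
proof (rule winding_number_subpath_log_lift [where k = "-1" and l = "\<lambda>s. L (s, t)"])
  show "continuous_on {u..v} (\<lambda>s. L (s, t))"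
    by (rule continuous_on_compose2 [OF L]) (use P in \<open>auto intro!: continuous_intros\<close>)
  show "G s - G t = - 1 * exp (L (s, t))" if "s \<in> {u..v}" for s
    using eq [of s t] subsetD [OF P, of "(s, t)"] that by (auto simp: algebra_simps)
qed (use assms in auto)

lemma secant_log_snd:
  assumes L: "continuous_on P L"
    and eq: "\<And>s t. (s, t) \<in> P \<Longrightarrow> G t - G s = exp (L (s, t))"
    and "u \<le> v" and P: "{s} \<times> {u..v} \<subseteq> P"
  shows "L (s, v) - L (s, u) = 2 * of_real pi * \<i> * winding_number (subpath u v G) (G s)"
proof (rule winding_number_subpath_log_lift [where k = 1 and l = "\<lambda>t. L (s, t)"])
  show "continuous_on {u..v} (\<lambda>t. L (s, t))"
    by (rule continuous_on_compose2 [OF L]) (use P in \<open>auto intro!: continuous_intros\<close>)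
  show "G t - G s = 1 * exp (L (s, t))" if "t \<in> {u..v}" for t
    using eq [of s t] subsetD [OF P, of "(s, t)"] that by auto
qed (use assms in auto)

text \<open>Both sides measure how a logarithm of \<open>q t - p s\<close> changes from one corner of the unit
  square to the opposite one.\<close>

lemma winding_number_square:
  assumes "path p" "path q" and disj: "path_image p \<inter> path_image q = {}"
  shows "winding_number q (pathstart p) + winding_number p (pathfinish q)
       = winding_number p (pathstart q) + winding_number q (pathfinish p)"
proof -
  let ?P = "{0..1::real} \<times> {0..1::real}"
  have cont: "continuous_on {0..1} p" "continuous_on {0..1} q"
    using assms by (auto simp: path_def)
  have F: "continuous_on ?P (\<lambda>x. q (snd x) - p (fst x))"
    by (intro continuous_intros continuous_on_compose2 [OF cont(1)] continuous_on_compose2 [OF cont(2)]) auto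
  have nz: "q (snd x) - p (fst x) \<noteq> 0" if "x \<in> ?P" for x
  proof -
    have "p (fst x) \<in> path_image p" "q (snd x) \<in> path_image q"
      using that by (auto simp: path_image_def)
    then show ?thesis using disj by auto
  qed
  have "contractible ?P"
    by (intro convex_imp_contractible convex_Times convex_real_interval)
  from continuous_logarithm_on_contractible [OF F this nz]
  obtain L where L: "continuous_on ?P L" and eq: "\<And>x. x \<in> ?P \<Longrightarrow> q (snd x) - p (fst x) = exp (L x)"
    by metis
  have h: "L (1, t) - L (0, t) = 2 * of_real pi * \<i> * winding_number p (q t)" if "t \<in> {0..1}" for t
  proof (rule winding_number_log_lift [where k = "-1" and l = "\<lambda>s. L (s, t)"])
    show "continuous_on {0..1} (\<lambda>s. L (s, t))"
      by (rule continuous_on_compose2 [OF L]) (use that in \<open>auto intro!: continuous_intros\<close>)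
    show "p s - q t = - 1 * exp (L (s, t))" if "s \<in> {0..1}" for s
      using eq [of "(s, t)"] that \<open>t \<in> {0..1}\<close> by (auto simp: algebra_simps)
  qed auto
  have v: "L (s, 1) - L (s, 0) = 2 * of_real pi * \<i> * winding_number q (p s)" if "s \<in> {0..1}" for s
  proof (rule winding_number_log_lift [where k = 1 and l = "\<lambda>t. L (s, t)"])
    show "continuous_on {0..1} (\<lambda>t. L (s, t))"
      by (rule continuous_on_compose2 [OF L]) (use that in \<open>auto intro!: continuous_intros\<close>)
    show "q t - p s = 1 * exp (L (s, t))" if "t \<in> {0..1}" for t
      using eq [of "(s, t)"] that \<open>s \<in> {0..1}\<close> by auto
  qed auto
  let ?c = "2 * of_real pi * \<i>"
  have "?c * (winding_number q (p 0) + winding_number p (q 1))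
      = ?c * (winding_number p (q 0) + winding_number q (p 1))"
    using h [of 0] h [of 1] v [of 0] v [of 1] by (simp add: algebra_simps)
  then have "winding_number q (p 0) + winding_number p (q 1) = winding_number p (q 0) + winding_number q (p 1)"
    by (subst (asm) mult_cancel_left) auto
  then show ?thesis
    by (simp add: pathstart_def pathfinish_def)
qed

section \<open>Hopf's Umlaufsatz for continuous simple closed curves\<close>

text \<open>The crosscut is perpendicular to the chord. One of the two half discs about
  \<open>c\<close> belongs to the region between \<open>c1\<close> and the chord; the ray into this
  half disc is followed until it leaves the region, and it can do so only through
  \<open>c1\<close>.\<close>

lemma chord_crosscut:
  fixes c1 c2 :: "real \<Rightarrow> complex"
  assumes c1: "arc c1" "pathstart c1 = a" "pathfinish c1 = b"
    and c2: "arc c2" "pathstart c2 = b" "pathfinish c2 = a"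
    and c12: "path_image c1 \<inter> path_image c2 = {a, b}"
    and c: "c \<in> open_segment a b"
    and chord: "open_segment a b \<subseteq> inside (path_image c1 \<union> path_image c2)"
  obtains q where "q \<in> path_image c1" "q \<noteq> a" "q \<noteq> b" "q \<noteq> c"
    "open_segment c q \<subseteq> inside (path_image c1 \<union> closed_segment a b)"
    "closed_segment c q \<inter> closed_segment a b = {c}"
    "inside (path_image c1 \<union> closed_segment a b) \<inter> path_image c2 = {}"
proof -
  have "a \<noteq> b" using c by auto
  let ?J = "path_image c1 \<union> path_image c2"
  let ?J1 = "path_image c1 \<union> closed_segment a b"
  define S where "S = inside ?J1"
  have "open_segment a b \<inter> ?J = {}"
    using chord inside_no_overlap by blast
  then have seg: "closed_segment a b \<inter> path_image c1 = {a, b}" "closed_segment a b \<inter> path_image c2 = {a, b}"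
    using c1 c2 c12 by (auto simp: open_segment_def)
  have loop1: "simple_path (c1 +++ linepath b a)" "pathfinish (c1 +++ linepath b a) = pathstart (c1 +++ linepath b a)"
    using c1 seg \<open>a \<noteq> b\<close>
    by (auto intro!: simple_path_join_loop simp: closed_segment_commute)
  have im1: "path_image (c1 +++ linepath b a) = ?J1"
    using c1 by (simp add: path_image_join closed_segment_commute)
  have S: "open S" "bounded S" "frontier S = ?J1"
    using Jordan_inside_outside [OF loop1] by (auto simp: S_def im1)
  have openJ: "open (inside ?J)"
  proof -
    have "simple_path (c1 +++ c2)"
      using c1 c2 c12 by (intro simple_path_join_loop) auto
    then show ?thesis
      using Jordan_inside_outside [of "c1 +++ c2"] c1 c2 by (auto simp: path_image_join)
  qed
  have "c \<in> closed_segment a b - {a, b}" using c by (simp add: open_segment_def)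
  then have "c \<in> inside ?J" using chord c by auto
  then obtain r0 where r0: "r0 > 0" "ball c r0 \<subseteq> inside ?J"
    using openJ openE by blast
  \<comment> \<open>The disc stays inside the whole loop and avoids \<open>a\<close> and
    \<open>b\<close>, so that it meets the line through \<open>a\<close> and \<open>b\<close> only
    within the chord.\<close>
  define r where "r = min r0 (min (dist c a) (dist c b))"
  have r: "r > 0" "ball c r \<subseteq> inside ?J"
    using r0 c by (auto simp: r_def open_segment_def)
  have ab_off: "a \<notin> ball c r" "b \<notin> ball c r" by (auto simp: r_def)
  have "c \<in> closure S"
    using S(3) \<open>c \<in> closed_segment a b - {a, b}\<close> by (auto simp: frontier_def)
  then obtain y where y: "y \<in> S" "y \<in> ball c r"
    using r(1) by (metis closure_approachable dist_commute mem_ball)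
  \<comment> \<open>\<open>\<phi>\<close> vanishes exactly on the line through \<open>a\<close> and
    \<open>b\<close>, and its sign tells the side. The point \<open>y\<close> of the region, taken
    close to \<open>c\<close>, selects one.\<close>
  define \<phi> where "\<phi> x = Im ((x - c) / (b - a))" for x
  have line: "x = c + of_real (Re ((x - c) / (b - a))) * (b - a)" if "\<phi> x = 0" for x
  proof -
    have "(x - c) / (b - a) = of_real (Re ((x - c) / (b - a)))"
      using that by (simp add: \<phi>_def complex_eq_iff)
    then show ?thesis using \<open>a \<noteq> b\<close> by (simp add: field_simps)
  qed
  obtain u where u: "c = (1 - u) *\<^sub>R a + u *\<^sub>R b" "0 < u" "u < 1"
    using c by (auto simp: in_segment)
  have seg0: "\<phi> x = 0" if x: "x \<in> closed_segment a b" for x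
  proof -
    obtain v where v: "x = (1 - v) *\<^sub>R a + v *\<^sub>R b"
      using x by (auto simp: in_segment)
    have "x - c = of_real (v - u) * (b - a)"
      by (simp add: v u(1) algebra_simps scaleR_conv_of_real)
    then show ?thesis using \<open>a \<noteq> b\<close> by (simp add: \<phi>_def)
  qed
  have ball_line: "x \<in> closed_segment a b" if "x \<in> ball c r" "\<phi> x = 0" for x
  proof -
    define t where "t = Re ((x - c) / (b - a))"
    have x: "x = c + of_real t * (b - a)" using line [OF that(2)] by (simp add: t_def)
    have "dist c x = \<bar>t\<bar> * norm (b - a)"
      by (simp add: x dist_norm norm_mult)
    moreover have "c - a = of_real u * (b - a)" "c - b = of_real (1 - u) * (a - b)"
      by (simp_all add: u(1) algebra_simps scaleR_conv_of_real)
    then have "dist c a = u * norm (b - a)" "dist c b = (1 - u) * norm (b - a)"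
      using u(2,3) by (auto simp: dist_norm norm_mult norm_minus_commute simp del: of_real_diff)
    ultimately have "\<bar>t\<bar> * norm (b - a) < u * norm (b - a)" "\<bar>t\<bar> * norm (b - a) < (1 - u) * norm (b - a)"
      using that(1) by (auto simp: r_def)
    then have "\<bar>t\<bar> < u" "\<bar>t\<bar> < 1 - u" using \<open>a \<noteq> b\<close> by auto
    moreover have "x = (1 - (u + t)) *\<^sub>R a + (u + t) *\<^sub>R b"
      by (simp add: x u(1) algebra_simps scaleR_conv_of_real)
    ultimately show ?thesis
      unfolding in_segment by (intro exI [of _ "u + t"]) auto
  qed
  have "\<phi> y \<noteq> 0"
    using ball_line y inside_no_overlap by (fastforce simp: S_def)
  define \<sigma> where "\<sigma> = sgn (\<phi> y)"
  have \<sigma>: "\<sigma> * \<sigma> = 1" "\<sigma> * \<phi> y > 0" "\<bar>\<sigma>\<bar> = 1"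
    using \<open>\<phi> y \<noteq> 0\<close> by (auto simp: \<sigma>_def sgn_if)
  \<comment> \<open>The open half disc on the side of \<open>y\<close>. It meets neither the chord
    nor \<open>c1\<close>, hence not the frontier of \<open>S\<close>, and being connected it lies
    in \<open>S\<close> entirely.\<close>
  define H where "H = ball c r \<inter> {x. 0 < \<sigma> * \<phi> x}"
  have "convex {x. 0 < \<sigma> * \<phi> x}"
  proof (rule convexI)
    fix x x' and s t :: real
    assume *: "x \<in> {x. 0 < \<sigma> * \<phi> x}" "x' \<in> {x. 0 < \<sigma> * \<phi> x}" "0 \<le> s" "0 \<le> t" "s + t = 1"
    have "(s + t) *\<^sub>R c = c" using *(5) by simp
    then have "s *\<^sub>R x + t *\<^sub>R x' - c = s *\<^sub>R (x - c) + t *\<^sub>R (x' - c)"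
      by (simp add: algebra_simps)
    then have "(s *\<^sub>R x + t *\<^sub>R x' - c) / (b - a) = s *\<^sub>R ((x - c) / (b - a)) + t *\<^sub>R ((x' - c) / (b - a))"
      by (simp add: divide_inverse distrib_right)
    then have "\<sigma> * \<phi> (s *\<^sub>R x + t *\<^sub>R x') = s * (\<sigma> * \<phi> x) + t * (\<sigma> * \<phi> x')"
      by (simp add: \<phi>_def distrib_left)
    moreover have "0 < s * (\<sigma> * \<phi> x) + t * (\<sigma> * \<phi> x')"
      using * by (cases "s = 0") (auto intro: add_pos_nonneg mult_pos_pos mult_nonneg_nonneg)
    ultimately show "s *\<^sub>R x + t *\<^sub>R x' \<in> {x. 0 < \<sigma> * \<phi> x}" by simp
  qed
  then have "topological_space_class.connected H"
    unfolding H_def by (intro convex_connected convex_Int convex_ball)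
  moreover have "H \<inter> ?J1 = {}"
  proof (rule ccontr)
    assume "H \<inter> ?J1 \<noteq> {}"
    then obtain x where x: "x \<in> H" "x \<in> ?J1" by blast
    then have "x \<in> inside ?J" using r(2) by (auto simp: H_def)
    then have "x \<notin> path_image c1" using inside_no_overlap [of ?J] by blast
    then have "\<phi> x = 0" using x seg0 by blast
    then show False using x by (simp add: H_def)
  qed
  ultimately have "H \<inter> frontier S = {}" "topological_space_class.connected H" using S(3) by auto
  moreover have "y \<in> H \<inter> S" using y \<sigma> by (auto simp: H_def)
  ultimately have HS: "H \<subseteq> S"
    using connected_Int_frontier [of H S] by blast
  define d where "d = of_real \<sigma> * \<i> * (b - a)"
  have d: "d \<noteq> 0" "norm d > 0" using \<sigma> \<open>a \<noteq> b\<close> by (auto simp: d_def norm_mult)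
  have \<phi>d: "\<sigma> * \<phi> (c + x *\<^sub>R d) = x" for x
  proof -
    have "(c + x *\<^sub>R d - c) / (b - a) = of_real (x * \<sigma>) * \<i>"
      using \<open>a \<noteq> b\<close> by (simp add: d_def scaleR_conv_of_real)
    then have "\<sigma> * \<phi> (c + x *\<^sub>R d) = \<sigma> * \<sigma> * x"
      by (simp add: \<phi>_def)
    then show ?thesis using \<sigma> by simp
  qed
  define h where "h = r / (2 * norm d)"
  have h: "h > 0" using r d by (simp add: h_def)
  have inH: "c + x *\<^sub>R d \<in> S" if "0 < x" "x \<le> h" for x
  proof -
    have "dist c (c + x *\<^sub>R d) = x * norm d"
      using that by (simp add: dist_norm)
    also have "\<dots> \<le> h * norm d" using that d by (simp add: mult_right_mono)
    also have "\<dots> < r" using d r by (simp add: h_def)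
    finally show ?thesis
      using \<phi>d that HS by (auto simp: H_def)
  qed
  \<comment> \<open>\<open>c\<close> itself is on the frontier of \<open>S\<close>, so the ray is
    started half a radius away. It does not return to the line of the chord, hence its exit point is
    on \<open>c1\<close>.\<close>
  have "c + h *\<^sub>R d \<in> interior S"
    using inH [of h] h S(1) by (simp add: interior_open)
  then obtain e where e: "0 < e" "c + h *\<^sub>R d + e *\<^sub>R d \<in> frontier S"
    "\<And>e'. 0 \<le> e' \<Longrightarrow> e' < e \<Longrightarrow> c + h *\<^sub>R d + e' *\<^sub>R d \<in> interior S"
    using ray_to_frontier [OF S(2) _ d(1)] by metis
  define q where "q = c + (h + e) *\<^sub>R d"
  have inS: "c + x *\<^sub>R d \<in> S" if "0 < x" "x < h + e" for x
  proof (cases "x \<le> h")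
    case True
    then show ?thesis using inH that by blast
  next
    case False
    then show ?thesis using e(3) [of "x - h"] that S(1) by (simp add: interior_open algebra_simps)
  qed
  have q_seg: "q \<notin> closed_segment a b"
    using seg0 [of q] \<phi>d [of "h + e"] h e(1) by (auto simp: q_def)
  have cq: "\<exists>x. 0 < x \<and> x < h + e \<and> z = c + x *\<^sub>R d" if z: "z \<in> open_segment c q" for z
  proof -
    obtain v where "0 < v" and "v < 1" and "z = (1 - v) *\<^sub>R c + v *\<^sub>R q"
      using z by (auto simp: in_segment)
    moreover have "0 < v * (h + e)" "v * (h + e) < 1 * (h + e)"
      using h e(1) \<open>0 < v\<close> \<open>v < 1\<close> by (auto intro: mult_strict_right_mono)
    moreover have "z = c + (v * (h + e)) *\<^sub>R d"
      using \<open>z = _\<close> by (simp add: q_def algebra_simps)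
    ultimately show ?thesis by auto
  qed
  show ?thesis
  proof
    have "q \<in> ?J1" using e(2) S(3) by (simp add: q_def algebra_simps)
    then show "q \<in> path_image c1" using q_seg by blast
    show "q \<noteq> a" "q \<noteq> b" "q \<noteq> c" using q_seg c by (auto simp: open_segment_def)
    show 1: "open_segment c q \<subseteq> inside ?J1"
      using cq inS by (force simp: S_def)
    show "closed_segment c q \<inter> closed_segment a b = {c}"
    proof -
      have "open_segment c q \<inter> closed_segment a b = {}"
        using 1 inside_no_overlap by blast
      then show ?thesis
        using q_seg c by (auto simp: open_segment_def)
    qed
    \<comment> \<open>The chord divides the inside of the whole loop. The part bounded by
      \<open>c1\<close> and the chord is therefore free of points of \<open>c2\<close>.\<close>
    have "inside (path_image c1 \<union> path_image (linepath a b)) \<subseteq> inside (path_image c1 \<union> path_image (reversepath c2))"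
    proof (rule split_inside_simple_closed_curve [of c1 a b "reversepath c2" "linepath a b"])
      show "path_image (linepath a b) \<inter> inside (path_image c1 \<union> path_image (reversepath c2)) \<noteq> {}"
        using c chord by (auto simp: open_segment_def)
    qed (use c1 c2 c12 seg \<open>a \<noteq> b\<close> in \<open>auto simp: arc_imp_simple_path arc_reversepath\<close>)
    then have "inside ?J1 \<subseteq> inside ?J" by simp
    then show "inside ?J1 \<inter> path_image c2 = {}"
      using inside_no_overlap [of ?J] by blast
  qed
qed

text \<open>
  The increment of the logarithm of \<open>c2 t - c1 s\<close> along the two arcs cut off by a chord is compared
  with the one where \<open>s\<close> runs along the chord.  A crosscut from \<open>c\<close> to \<open>c1 m\<close> on the
  side of \<open>c1\<close> splits the difference into windings of two loops about points outside of them.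
\<close>

lemma chord_winding:
  fixes c1 c2 :: "real \<Rightarrow> complex"
  assumes c1: "arc c1" "pathstart c1 = a" "pathfinish c1 = b"
    and c2: "arc c2" "pathstart c2 = b" "pathfinish c2 = a"
    and c12: "path_image c1 \<inter> path_image c2 = {a, b}"
    and c: "c \<in> open_segment a b"
    and chord: "open_segment a b \<subseteq> inside (path_image c1 \<union> path_image c2)"
  obtains m where "0 < m" "m < 1"
    "winding_number (subpath 0 m c1) b + winding_number c2 (c1 m) + winding_number (subpath m 1 c1) a
      = winding_number c2 c - winding_number (linepath c a) b - winding_number (linepath b c) a"
proof -
  let ?J1 = "path_image c1 \<union> closed_segment a b"
  obtain q where q: "q \<in> path_image c1" "q \<noteq> a" "q \<noteq> b" "q \<noteq> c"
    "open_segment c q \<subseteq> inside ?J1"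
    "closed_segment c q \<inter> closed_segment a b = {c}"
    "inside ?J1 \<inter> path_image c2 = {}"
    using chord_crosscut [OF assms] by blast
  obtain m where m: "m \<in> {0..1}" "c1 m = q"
    using q(1) by (auto simp: path_image_def)
  with q c1 have m01: "0 < m" "m < 1"
    by (metis atLeastAtMost_iff order_le_less pathfinish_def pathstart_def)+
  have inj: "inj_on c1 {0..1}" and "path c1" "path c2"
    using c1 c2 by (auto simp: arc_def)
  define u where "u = subpath 0 m c1"
  define v where "v = subpath m 1 c1"
  have "arc u" "arc v"
    unfolding u_def v_def using c1 m01 by (auto intro!: arc_subpath_arc)
  moreover have "pathstart u = a" "pathfinish u = q" "pathstart v = q" "pathfinish v = b"
    using c1 m by (auto simp: u_def v_def pathstart_def pathfinish_def subpath_def)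
  ultimately have uv: "arc u" "arc v" "pathstart u = a" "pathfinish u = q" "pathstart v = q" "pathfinish v = b"
    by auto
  have "path u" "path v" using uv by (auto simp: arc_imp_path)
  have im: "path_image u = c1 ` {0..m}" "path_image v = c1 ` {m..1}"
    using m01 by (auto simp: u_def v_def path_image_subpath)
  have c1_eq: "path_image c1 = path_image u \<union> path_image v"
  proof -
    have "{0..1} = {0..m} \<union> {m..1}" using m01 by auto
    then show ?thesis by (simp add: im path_image_def [of c1] image_Un)
  qed
  have uv_int: "path_image u \<inter> path_image v = {q}"
  proof -
    have "c1 ` {0..m} \<inter> c1 ` {m..1} = c1 ` ({0..m} \<inter> {m..1})"
      using m01 by (intro inj_on_image_Int [OF inj, symmetric]) auto
    also have "{0..m} \<inter> {m..1} = {m}" using m01 by auto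
    finally show ?thesis using m by (simp add: im)
  qed
  have ab: "a \<in> path_image u" "b \<in> path_image v" "a \<notin> path_image v" "b \<notin> path_image u"
  proof -
    show a: "a \<in> path_image u" and b: "b \<in> path_image v"
      using uv pathstart_in_path_image [of u] pathfinish_in_path_image [of v] by auto
    show "a \<notin> path_image v" "b \<notin> path_image u"
      using a b uv_int q(2,3) by auto
  qed
  have "c \<noteq> a" "c \<noteq> b" "a \<noteq> b" and c_seg: "c \<in> closed_segment a b"
    using c by (auto simp: open_segment_def)
  have "open_segment a b \<inter> (path_image c1 \<union> path_image c2) = {}"
    using chord inside_no_overlap by blast
  then have seg: "closed_segment a b \<inter> path_image c1 = {a, b}" "closed_segment a b \<inter> path_image c2 = {a, b}"
    using c12 by (auto simp: open_segment_def)
  have split: "closed_segment a c \<union> closed_segment c b = closed_segment a b"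
    "closed_segment a c \<inter> closed_segment c b = {c}"
    using c_seg by (auto simp: Un_closed_segment intro!: Int_closed_segment)
  have b_notin: "b \<notin> closed_segment a c" and a_notin: "a \<notin> closed_segment c b"
    using split(2) \<open>c \<noteq> a\<close> \<open>c \<noteq> b\<close> by (metis Int_iff ends_in_segment singletonD)+
  have k: "closed_segment c q \<inter> path_image c1 = {q}"
  proof -
    have "open_segment c q \<inter> path_image c1 = {}" using q(5) inside_no_overlap by blast
    moreover have "c \<notin> path_image c1" using seg c_seg \<open>c \<noteq> a\<close> \<open>c \<noteq> b\<close> by blast
    ultimately show ?thesis using q(1) by (auto simp: open_segment_def)
  qed
  have x: "closed_segment a c \<inter> path_image v = {}" "closed_segment c b \<inter> path_image u = {}"
    "closed_segment a c \<inter> path_image u = {a}" "closed_segment c b \<inter> path_image v = {b}"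
    using seg(1) split(1) b_notin a_notin ab ends_in_segment unfolding c1_eq by fast+
  define p1 where "p1 = linepath c a +++ u"
  define p2 where "p2 = linepath c b +++ reversepath v"
  let ?k = "linepath c q"
  have im12: "path_image p1 = closed_segment a c \<union> path_image u"
    "path_image p2 = closed_segment c b \<union> path_image v"
    using uv by (simp_all add: p1_def p2_def path_image_join closed_segment_commute)
  have J1: "path_image p1 \<union> path_image p2 = ?J1"
    using split c1_eq im12 by blast
  have "arc p1" unfolding p1_def
    using uv x \<open>c \<noteq> a\<close> by (intro arc_join) (simp_all add: closed_segment_commute)
  moreover have "arc p2" unfolding p2_def
    using uv x \<open>c \<noteq> b\<close> by (intro arc_join) (simp_all add: arc_reversepath)
  ultimately have simple: "simple_path p1" "simple_path p2" by (auto simp: arc_imp_simple_path)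
  have ends: "pathstart p1 = c" "pathfinish p1 = q" "pathstart p2 = c" "pathfinish p2 = q"
    using uv by (simp_all add: p1_def p2_def)
  have p12: "path_image p1 \<inter> path_image p2 = {c, q}"
    using split(2) uv_int x unfolding im12 by blast
  have pk: "path_image p1 \<inter> path_image ?k = {c, q}" "path_image p2 \<inter> path_image ?k = {c, q}"
  proof -
    have "q \<in> path_image u" "q \<in> path_image v" using uv_int by auto
    then show "path_image p1 \<inter> path_image ?k = {c, q}" "path_image p2 \<inter> path_image ?k = {c, q}"
      using k q(6) split(1) ends_in_segment unfolding c1_eq im12 path_image_linepath by fast+
  qed
  have meets: "path_image ?k \<inter> inside (path_image p1 \<union> path_image p2) \<noteq> {}"
  proof -
    have "midpoint c q \<in> open_segment c q" using q(4) by auto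
    then have "midpoint c q \<in> inside (path_image p1 \<union> path_image p2)" "midpoint c q \<in> path_image ?k"
      using q(5) J1 open_closed_segment by auto
    then show ?thesis by blast
  qed
  have "inside (path_image p1 \<union> path_image ?k) \<union> inside (path_image p2 \<union> path_image ?k)
      \<union> (path_image ?k - {c, q}) = inside (path_image p1 \<union> path_image p2)"
    by (rule split_inside_simple_closed_curve
        [OF simple(1) ends(1,2) simple(2) ends(3,4) simple_path_linepath [OF q(4) [symmetric]]
            pathstart_linepath pathfinish_linepath q(4) [symmetric] p12 pk meets])
  then have sub: "inside (path_image p1 \<union> path_image ?k) \<subseteq> inside ?J1"
    "inside (path_image p2 \<union> path_image ?k) \<subseteq> inside ?J1"
    unfolding J1 by blast+
  have "a \<in> ?J1" "b \<in> ?J1" by auto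
  then have ab_notin: "a \<notin> inside ?J1" "b \<notin> inside ?J1"
    using inside_no_overlap by blast+
  have ab_k: "a \<notin> closed_segment c q" "b \<notin> closed_segment c q"
    using q(6) \<open>c \<noteq> a\<close> \<open>c \<noteq> b\<close> by (metis IntI ends_in_segment singletonD)+
  have b_p1: "b \<notin> path_image p1" using b_notin ab by (simp add: im12)
  have a_p2: "a \<notin> path_image p2" using a_notin ab by (simp add: im12)
  have paths: "path p1" "path p2" using simple by (auto simp: simple_path_def)
  \<comment> \<open>\<open>b\<close> belongs to \<open>?J1\<close> but not to this loop, whose
    inside is part of \<open>inside ?J1\<close>; so the loop does not wind around \<open>b\<close>.
    The same holds for \<open>a\<close> and the other loop.\<close>
  have "winding_number (p1 +++ reversepath ?k) b = 0"
  proof (rule winding_number_zero_in_outside)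
    have "b \<notin> inside (path_image p1 \<union> path_image ?k)" using sub ab_notin by blast
    then show "b \<in> outside (path_image (p1 +++ reversepath ?k))"
      using b_p1 ab_k ends by (simp add: path_image_join outside_inside closed_segment_commute)
  qed (use ends paths in auto)
  moreover have "winding_number (p1 +++ reversepath ?k) b
      = winding_number (linepath c a) b + winding_number u b - winding_number ?k b"
  proof -
    have "winding_number (p1 +++ reversepath ?k) b = winding_number p1 b + winding_number (reversepath ?k) b"
      using paths b_p1 ab_k ends by (intro winding_number_join) (auto simp: closed_segment_commute)
    moreover have "winding_number (reversepath ?k) b = - winding_number ?k b"
      using ab_k by (intro winding_number_reversepath) auto
    moreover have "winding_number p1 b = winding_number (linepath c a) b + winding_number u b"
      unfolding p1_def using uv \<open>path u\<close> b_notin ab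
      by (intro winding_number_join) (auto simp: closed_segment_commute)
    ultimately show ?thesis by simp
  qed
  ultimately have e1: "winding_number u b = winding_number ?k b - winding_number (linepath c a) b"
    by (simp add: algebra_simps)
  have "winding_number (p2 +++ reversepath ?k) a = 0"
  proof (rule winding_number_zero_in_outside)
    have "a \<notin> inside (path_image p2 \<union> path_image ?k)" using sub ab_notin by blast
    then show "a \<in> outside (path_image (p2 +++ reversepath ?k))"
      using a_p2 ab_k ends by (simp add: path_image_join outside_inside closed_segment_commute)
  qed (use ends paths in auto)
  moreover have "winding_number (p2 +++ reversepath ?k) a
      = - winding_number (linepath b c) a - winding_number v a - winding_number ?k a"
  proof -
    have "winding_number (p2 +++ reversepath ?k) a = winding_number p2 a + winding_number (reversepath ?k) a"
      using paths a_p2 ab_k ends by (intro winding_number_join) (auto simp: closed_segment_commute)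
    moreover have "winding_number (reversepath ?k) a = - winding_number ?k a"
      using ab_k by (intro winding_number_reversepath) auto
    moreover have "winding_number p2 a = winding_number (linepath c b) a + winding_number (reversepath v) a"
      unfolding p2_def using uv \<open>path v\<close> a_notin ab
      by (intro winding_number_join) auto
    moreover have "winding_number (reversepath v) a = - winding_number v a"
      using \<open>path v\<close> ab by (intro winding_number_reversepath) auto
    moreover have "winding_number (linepath c b) a = - winding_number (linepath b c) a"
      using winding_number_reversepath [of "linepath b c" a] a_notin by (simp add: closed_segment_commute)
    ultimately show ?thesis by simp
  qed
  ultimately have e2: "winding_number v a = - winding_number (linepath b c) a - winding_number ?k a"
    by (simp add: algebra_simps)
  \<comment> \<open>As the crosscut misses \<open>c2\<close>, the winding of \<open>c2\<close> about
    \<open>q\<close> can be carried over to \<open>c\<close>. The price is the windings of the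
    crosscut about \<open>a\<close> and \<open>b\<close>, and these cancel against \<open>e1\<close>
    and \<open>e2\<close>.\<close>
  have "path_image ?k \<inter> path_image c2 = {}"
  proof -
    have "c \<notin> path_image c2" using seg c_seg \<open>c \<noteq> a\<close> \<open>c \<noteq> b\<close> by blast
    moreover have "q \<notin> path_image c2" using q(1,2,3) c12 by blast
    ultimately show ?thesis using q(5,7) by (auto simp: open_segment_def)
  qed
  from winding_number_square [OF _ \<open>path c2\<close> this]
  have sq: "winding_number c2 q = winding_number c2 c + winding_number ?k a - winding_number ?k b"
    using c2 by (simp add: algebra_simps)
  show ?thesis
    by (rule that [OF m01]) (simp add: u_def [symmetric] v_def [symmetric] m(2) e1 e2 sq)
qed

section \<open>Secants of a closed curve over a strip of parameters\<close>

text \<open>Continuation of a closed curve by a second turn; the secants below never need a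
  parameter beyond 2.\<close>

definition unroll :: "(real \<Rightarrow> complex) \<Rightarrow> real \<Rightarrow> complex" where
  "unroll g t = (if t \<le> 1 then g t else g (t - 1))"

text \<open>The border lines \<open>t = s\<close> and \<open>t = s + 1\<close>, where the secant
  vanishes, are left out. Both \<open>s = 0\<close> and \<open>s = 1\<close> are included, so that
  the strip contains both ends \<open>(0, t)\<close> and \<open>(1, t + 1)\<close> of a full turn.
  Its convexity provides the logarithm.\<close>

definition strip :: "(real \<times> real) set" where
  "strip = {(s, t). 0 \<le> s \<and> s \<le> 1 \<and> s < t \<and> t < s + 1}"

lemma mem_strip [simp]: "(s, t) \<in> strip \<longleftrightarrow> 0 \<le> s \<and> s \<le> 1 \<and> s < t \<and> t < s + 1"
  by (simp add: strip_def)

lemma convex_strip: "convex strip"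
proof -
  have eq: "strip = {x. (1, 0) \<bullet> x \<ge> 0} \<inter> {x. (1, 0) \<bullet> x \<le> 1} \<inter> {x. (-1, 1) \<bullet> x > 0} \<inter> {x. (-1, 1) \<bullet> x < 1}"
    by (auto simp: strip_def)
  show ?thesis
    unfolding eq by (intro convex_Int convex_halfspace_ge convex_halfspace_le convex_halfspace_gt convex_halfspace_lt)
qed

context
  fixes g :: "real \<Rightarrow> complex"
  assumes g: "simple_path g" "pathfinish g = pathstart g"
begin

lemma unroll_plus_one: "t \<in> {0..1} \<Longrightarrow> unroll g (t + 1) = unroll g t"
  using g(2) by (auto simp: unroll_def pathstart_def pathfinish_def)

lemma continuous_on_unroll: "continuous_on {0..2} (unroll g)"
proof -
  have c: "continuous_on {0..1} g" using g(1) by (simp add: simple_path_def path_def)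
  have "continuous_on ({0..1} \<union> {1..2}) (\<lambda>t. if t \<le> 1 then g t else g (t - 1))"
  proof (rule continuous_on_cases)
    show "continuous_on {1..2} (\<lambda>t. g (t - 1))"
      by (rule continuous_on_compose2 [OF c]) (auto intro!: continuous_intros)
    show "\<forall>t. t \<in> {0..1} \<and> \<not> t \<le> 1 \<or> t \<in> {1..2} \<and> t \<le> 1 \<longrightarrow> g t = g (t - 1)"
      using g(2) by (auto simp: pathstart_def pathfinish_def)
  qed (use c in auto)
  moreover have "{0..1} \<union> {1..2::real} = {0..2}" by auto
  ultimately show ?thesis unfolding unroll_def [abs_def] by simp
qed

lemma unroll_neq:
  assumes "(s, t) \<in> strip"
  shows "unroll g s \<noteq> unroll g t"
proof
  assume eq: "unroll g s = unroll g t"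
  have inj: "x = y \<or> x = 0 \<and> y = 1 \<or> x = 1 \<and> y = 0" if "x \<in> {0..1}" "y \<in> {0..1}" "g x = g y" for x y
    using g(1) that by (auto simp: simple_path_def loop_free_def)
  show False
    using eq inj [of s t] inj [of s "t - 1"] assms by (auto simp: unroll_def split: if_splits)
qed

lemma secant_log_exists:
  obtains L where "continuous_on strip L"
    "\<And>s t. (s, t) \<in> strip \<Longrightarrow> unroll g t - unroll g s = exp (L (s, t))"
proof -
  have "continuous_on strip (\<lambda>x. unroll g (snd x) - unroll g (fst x))"
    by (intro continuous_intros continuous_on_compose2 [OF continuous_on_unroll]) (auto simp: strip_def)
  then obtain L where "continuous_on strip L"
    "\<And>x. x \<in> strip \<Longrightarrow> unroll g (snd x) - unroll g (fst x) = exp (L x)"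
    using continuous_logarithm_on_contractible [OF _ convex_imp_contractible [OF convex_strip]] unroll_neq
    by (metis (no_types, lifting) prod.collapse right_minus_eq)
  then show ?thesis using that by fastforce
qed

text \<open>The horizontal line through \<open>z\<close> is followed to the left and to the right
  until it first meets the curve. Exchanging the two ends if necessary puts their parameters in
  order.\<close>

lemma chord_through:
  assumes z: "z \<in> inside (path_image g)"
  obtains \<alpha> \<beta> where "0 \<le> \<alpha>" "\<alpha> < \<beta>" "\<beta> < 1" "z \<in> open_segment (g \<alpha>) (g \<beta>)"
    "open_segment (g \<alpha>) (g \<beta>) \<subseteq> inside (path_image g)"
proof -
  let ?S = "inside (path_image g)"
  have S: "open ?S" "bounded ?S" "frontier ?S = path_image g"
    using Jordan_inside_outside [OF g] by auto
  have ray: "\<exists>d>0. z + of_real (d * e) \<in> path_image g \<and> (\<forall>x. 0 \<le> x \<and> x < d \<longrightarrow> z + of_real (x * e) \<in> ?S)"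
    if "e \<noteq> 0" for e :: real
    using ray_to_frontier [OF S(2), of z "of_real e"] z that S(1,3)
    by (metis interior_open of_real_eq_0_iff of_real_mult scaleR_conv_of_real)
  obtain p where p: "p > 0" "z + of_real p \<in> path_image g" "\<And>x. 0 \<le> x \<Longrightarrow> x < p \<Longrightarrow> z + of_real x \<in> ?S"
    using ray [of 1] by auto
  obtain n where n: "n > 0" "z - of_real n \<in> path_image g" "\<And>x. 0 \<le> x \<Longrightarrow> x < n \<Longrightarrow> z - of_real x \<in> ?S"
    using ray [of "-1"] by auto
  define a b where "a = z - of_real n" and "b = z + of_real p"
  have zab: "z \<in> open_segment a b"
    unfolding in_segment
  proof (intro conjI exI)
    show "a \<noteq> b" using p(1) n(1) by (simp add: a_def b_def complex_eq_iff)
    define v where "v = n / (n + p)"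
    show "0 < v" "v < 1" using p(1) n(1) by (auto simp: v_def)
    have "(1 - v) *\<^sub>R a + v *\<^sub>R b = z + of_real (v * (n + p) - n)"
      by (simp add: a_def b_def complex_eq_iff algebra_simps)
    also have "v * (n + p) = n" using p(1) n(1) by (simp add: v_def)
    finally show "z = (1 - v) *\<^sub>R a + v *\<^sub>R b" by simp
  qed
  have ab: "open_segment a b \<subseteq> ?S"
  proof
    fix x assume "x \<in> open_segment a b"
    then obtain u where u: "0 < u" "u < 1" "x = (1 - u) *\<^sub>R a + u *\<^sub>R b" by (auto simp: in_segment)
    define v where "v = u * (n + p) - n"
    have x: "x = z + of_real v" by (simp add: u(3) v_def a_def b_def complex_eq_iff algebra_simps)
    have "0 < u * (n + p)" "u * (n + p) < 1 * (n + p)"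
      using u p(1) n(1) by (auto intro: mult_strict_right_mono)
    then have "- n < v" "v < p" by (auto simp: v_def)
    then show "x \<in> ?S"
      using p(3) [of v] n(3) [of "-v"] by (cases "v \<ge> 0") (auto simp: x)
  qed
  have param: "\<exists>\<alpha>\<in>{0..<1}. g \<alpha> = x" if x: "x \<in> path_image g" for x
  proof -
    obtain t where "t \<in> {0..1}" "g t = x" using x by (auto simp: path_image_def)
    then show ?thesis
      using g(2) by (intro bexI [of _ "if t = 1 then 0 else t"]) (auto simp: pathstart_def pathfinish_def)
  qed
  obtain \<alpha> \<beta> where \<alpha>\<beta>: "\<alpha> \<in> {0..<1}" "\<beta> \<in> {0..<1}" "g \<alpha> = a" "g \<beta> = b"
    using param [of a] param [of b] p(2) n(2) by (auto simp: a_def b_def)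
  have "\<alpha> \<noteq> \<beta>" using zab \<alpha>\<beta> by auto
  then show ?thesis
    using that [of \<alpha> \<beta>] that [of \<beta> \<alpha>] \<alpha>\<beta> zab ab by (cases "\<alpha> < \<beta>") (auto simp: open_segment_commute)
qed

text \<open>
  The parameters \<open>(s, t)\<close> and \<open>(t, s + 1)\<close> have opposite secants, so the increment is
  constant and may be computed at the end points of a chord.  There \<open>chord_winding\<close> applies with either arc
  as \<open>c1\<close>, and the auxiliary windings cancel in the sum.
\<close>

lemma secant_log_half_turn:
  assumes L: "continuous_on strip L"
    and eq: "\<And>s t. (s, t) \<in> strip \<Longrightarrow> unroll g t - unroll g s = exp (L (s, t))"
    and z: "z \<in> inside (path_image g)"
    and st: "0 \<le> s" "s < t" "t \<le> 1" "t < s + 1"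
  shows "L (t, s + 1) - L (s, t) = of_real pi * \<i> * winding_number g z"
proof -
  let ?G = "unroll g" and ?w = "2 * of_real pi * \<i>"
  obtain \<alpha> \<beta> where \<alpha>\<beta>: "0 \<le> \<alpha>" "\<alpha> < \<beta>" "\<beta> < 1"
    and zin: "z \<in> open_segment (g \<alpha>) (g \<beta>)"
    and chord: "open_segment (g \<alpha>) (g \<beta>) \<subseteq> inside (path_image g)"
    using chord_through [OF z] by blast
  define c1 where "c1 = subpath \<alpha> \<beta> ?G"
  define c2 where "c2 = subpath \<beta> (\<alpha> + 1) ?G"
  \<comment> \<open>A piece shorter than a period is an arc. \<open>unroll_neq\<close> only covers
    pairs whose first parameter is at most 1; later pairs are shifted back by a period.\<close>
  have arc: "arc (subpath u v ?G)" if "0 \<le> u" "u \<le> 1" "u < v" "v < u + 1" for u v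
  proof -
    have sub: "(v - u) * x + u \<in> {u..v}" if "x \<in> {0..1}" for x
    proof -
      have "0 \<le> (v - u) * x" "(v - u) * x \<le> v - u"
        using that \<open>u < v\<close> by (auto intro: mult_left_le)
      then show ?thesis by simp
    qed
    have "path (subpath u v ?G)"
      unfolding path_def subpath_def
      by (rule continuous_on_compose2 [OF continuous_on_unroll])
         (use that sub in \<open>fastforce intro!: continuous_intros\<close>)+
    moreover have "inj_on (subpath u v ?G) {0..1}"
    proof (rule linorder_inj_onI')
      fix x y :: real assume xy: "x \<in> {0..1}" "y \<in> {0..1}" "x < y"
      have "?G s' \<noteq> ?G t'" if "s' \<in> {u..v}" "t' \<in> {u..v}" "s' < t'" for s' t'
      proof (cases "s' \<le> 1")
        case True
        then show ?thesis using unroll_neq [of s' t'] that \<open>0 \<le> u\<close> \<open>v < u + 1\<close> by auto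
      next
        case False
        then have "?G s' = ?G (s' - 1)" "?G t' = ?G (t' - 1)"
          using that \<open>u \<le> 1\<close> \<open>v < u + 1\<close> unroll_plus_one [of "s' - 1"] unroll_plus_one [of "t' - 1"] by auto
        then show ?thesis
          using False unroll_neq [of "s' - 1" "t' - 1"] that \<open>u \<le> 1\<close> \<open>0 \<le> u\<close> \<open>v < u + 1\<close> by auto
      qed
      then show "subpath u v ?G x \<noteq> subpath u v ?G y"
        using sub xy \<open>u < v\<close> by (auto simp: subpath_def)
    qed
    ultimately show ?thesis by (simp add: arc_def)
  qed
  have arcs: "arc c1" "arc c2"
    using \<alpha>\<beta> by (auto simp: c1_def c2_def intro!: arc)
  have Gab: "?G \<alpha> = g \<alpha>" "?G \<beta> = g \<beta>" "?G (\<alpha> + 1) = g \<alpha>"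
    using \<alpha>\<beta> unroll_plus_one [of \<alpha>] by (auto simp: unroll_def)
  have ends: "pathstart c1 = g \<alpha>" "pathfinish c1 = g \<beta>" "pathstart c2 = g \<beta>" "pathfinish c2 = g \<alpha>"
    using Gab by (auto simp: c1_def c2_def)
  have im: "path_image c1 = ?G ` {\<alpha>..\<beta>}" "path_image c2 = ?G ` {\<beta>..\<alpha>+1}"
    using \<alpha>\<beta> by (auto simp: c1_def c2_def path_image_subpath)
  have gG: "path_image g = ?G ` {\<alpha>..\<alpha>+1}"
  proof (intro equalityI subsetI)
    fix x assume "x \<in> path_image g"
    then obtain t where "t \<in> {0..1}" "x = g t" by (auto simp: path_image_def)
    then have "x = ?G t" "x = ?G (t + 1)" using unroll_plus_one [of t] by (auto simp: unroll_def)
    then show "x \<in> ?G ` {\<alpha>..\<alpha>+1}"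
      using \<open>t \<in> {0..1}\<close> \<alpha>\<beta> image_eqI [of x ?G t] image_eqI [of x ?G "t + 1"]
      by (cases "t \<ge> \<alpha>") auto
  next
    fix x assume "x \<in> ?G ` {\<alpha>..\<alpha>+1}"
    then obtain t where "t \<in> {\<alpha>..\<alpha>+1}" "x = ?G t" by auto
    then show "x \<in> path_image g"
      using \<alpha>\<beta> by (auto simp: unroll_def path_image_def)
  qed
  have "{\<alpha>..\<alpha>+1} = {\<alpha>..\<beta>} \<union> {\<beta>..\<alpha>+1}" using \<alpha>\<beta> by auto
  then have un: "path_image c1 \<union> path_image c2 = path_image g"
    by (simp add: im gG image_Un)
  have int: "path_image c1 \<inter> path_image c2 = {g \<alpha>, g \<beta>}"
  proof (intro equalityI subsetI)
    fix x assume "x \<in> path_image c1 \<inter> path_image c2"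
    then obtain s t where "s \<in> {\<alpha>..\<beta>}" "t \<in> {\<beta>..\<alpha>+1}" "?G s = x" "?G t = x" by (auto simp: im)
    then have "s = t \<or> t = s + 1"
      using unroll_neq [of s t] \<alpha>\<beta> by force
    then have "s = \<beta> \<or> s = \<alpha>" using \<open>s \<in> _\<close> \<open>t \<in> _\<close> by auto
    then show "x \<in> {g \<alpha>, g \<beta>}" using \<open>?G s = x\<close> Gab by auto
  next
    fix x assume "x \<in> {g \<alpha>, g \<beta>}"
    then show "x \<in> path_image c1 \<inter> path_image c2"
      using ends pathstart_in_path_image pathfinish_in_path_image by (metis IntI empty_iff insert_iff)
  qed
  note fst = secant_log_fst [OF L eq] and snd = secant_log_snd [OF L eq]
  have tele: "x3 - x0 = ?w * (p + q + r)"
    if "x1 - x0 = ?w * p" "x2 - x1 = ?w * q" "x3 - x2 = ?w * r" for x0 x1 x2 x3 p q r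
  proof -
    have "x3 - x0 = (x1 - x0) + (x2 - x1) + (x3 - x2)" by simp
    then show ?thesis unfolding that by (simp add: distrib_left)
  qed
  define w where "w p x = winding_number p x" for p :: "real \<Rightarrow> complex" and x
  \<comment> \<open>The corners \<open>(\<beta>, \<beta>)\<close> and
    \<open>(\<alpha>, \<alpha> + 1)\<close> are on the border of the strip, so neither parameter may
    go all the way alone. The first one stops at \<open>\<mu>\<close>, which belongs to the point
    \<open>c1 m\<close>, while the second one moves.\<close>
  have e1: "L (\<beta>, \<alpha> + 1) - L (\<alpha>, \<beta>)
      = ?w * (w c2 z - w (linepath z (g \<alpha>)) (g \<beta>) - w (linepath (g \<beta>) z) (g \<alpha>))"
  proof -
    obtain m where m: "0 < m" "m < 1"
      "w (subpath 0 m c1) (g \<beta>) + w c2 (c1 m) + w (subpath m 1 c1) (g \<alpha>)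
        = w c2 z - w (linepath z (g \<alpha>)) (g \<beta>) - w (linepath (g \<beta>) z) (g \<alpha>)"
      using chord_winding [of c1 "g \<alpha>" "g \<beta>" c2 z] arcs ends int zin chord un unfolding w_def by metis
    define \<mu> where "\<mu> = (\<beta> - \<alpha>) * m + \<alpha>"
    have "0 < (\<beta> - \<alpha>) * m" "(\<beta> - \<alpha>) * m < (\<beta> - \<alpha>) * 1"
      using m \<alpha>\<beta> by (auto intro: mult_strict_left_mono)
    then have \<mu>: "\<alpha> < \<mu>" "\<mu> < \<beta>" by (auto simp: \<mu>_def)
    have sub: "subpath 0 m c1 = subpath \<alpha> \<mu> ?G" "subpath m 1 c1 = subpath \<mu> \<beta> ?G" "c1 m = ?G \<mu>"
      by (auto simp: fun_eq_iff c1_def subpath_def \<mu>_def algebra_simps)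
    have "L (\<mu>, \<beta>) - L (\<alpha>, \<beta>) = ?w * w (subpath \<alpha> \<mu> ?G) (?G \<beta>)"
      unfolding w_def by (rule fst) (use \<mu> \<alpha>\<beta> in auto)
    moreover have "L (\<mu>, \<alpha> + 1) - L (\<mu>, \<beta>) = ?w * w (subpath \<beta> (\<alpha> + 1) ?G) (?G \<mu>)"
      unfolding w_def by (rule snd) (use \<mu> \<alpha>\<beta> in auto)
    moreover have "L (\<beta>, \<alpha> + 1) - L (\<mu>, \<alpha> + 1) = ?w * w (subpath \<mu> \<beta> ?G) (?G (\<alpha> + 1))"
      unfolding w_def by (rule fst) (use \<mu> \<alpha>\<beta> in auto)
    ultimately have "L (\<beta>, \<alpha> + 1) - L (\<alpha>, \<beta>)
        = ?w * (w (subpath 0 m c1) (g \<beta>) + w c2 (c1 m) + w (subpath m 1 c1) (g \<alpha>))"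
      unfolding sub Gab c2_def by (rule tele)
    then show ?thesis unfolding m(3) .
  qed
  \<comment> \<open>The same increment along another staircase: here the second parameter makes the
    stop, at a point of \<open>c2\<close>.\<close>
  have e2: "L (\<beta>, \<alpha> + 1) - L (\<alpha>, \<beta>)
      = ?w * (w c1 z - w (linepath z (g \<beta>)) (g \<alpha>) - w (linepath (g \<alpha>) z) (g \<beta>))"
  proof -
    obtain m where m: "0 < m" "m < 1"
      "w (subpath 0 m c2) (g \<alpha>) + w c1 (c2 m) + w (subpath m 1 c2) (g \<beta>)
        = w c1 z - w (linepath z (g \<beta>)) (g \<alpha>) - w (linepath (g \<alpha>) z) (g \<beta>)"
    proof (rule chord_winding [OF arcs(2) ends(3,4) arcs(1) ends(1,2)])
      show "path_image c2 \<inter> path_image c1 = {g \<beta>, g \<alpha>}" using int by blast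
      show "z \<in> open_segment (g \<beta>) (g \<alpha>)" using zin by (simp add: open_segment_commute)
      show "open_segment (g \<beta>) (g \<alpha>) \<subseteq> inside (path_image c2 \<union> path_image c1)"
        using chord un by (simp add: open_segment_commute Un_commute)
    qed (use that in \<open>auto simp: w_def\<close>)
    define \<mu> where "\<mu> = (\<alpha> + 1 - \<beta>) * m + \<beta>"
    have "0 < (\<alpha> + 1 - \<beta>) * m" "(\<alpha> + 1 - \<beta>) * m < (\<alpha> + 1 - \<beta>) * 1"
      using m \<alpha>\<beta> by (auto intro: mult_strict_left_mono)
    then have \<mu>: "\<beta> < \<mu>" "\<mu> < \<alpha> + 1" by (auto simp: \<mu>_def)
    have sub: "subpath 0 m c2 = subpath \<beta> \<mu> ?G" "subpath m 1 c2 = subpath \<mu> (\<alpha> + 1) ?G" "c2 m = ?G \<mu>"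
      by (auto simp: fun_eq_iff c2_def subpath_def \<mu>_def algebra_simps)
    have "L (\<alpha>, \<mu>) - L (\<alpha>, \<beta>) = ?w * w (subpath \<beta> \<mu> ?G) (?G \<alpha>)"
      unfolding w_def by (rule snd) (use \<mu> \<alpha>\<beta> in auto)
    moreover have "L (\<beta>, \<mu>) - L (\<alpha>, \<mu>) = ?w * w (subpath \<alpha> \<beta> ?G) (?G \<mu>)"
      unfolding w_def by (rule fst) (use \<mu> \<alpha>\<beta> in auto)
    moreover have "L (\<beta>, \<alpha> + 1) - L (\<beta>, \<mu>) = ?w * w (subpath \<mu> (\<alpha> + 1) ?G) (?G \<beta>)"
      unfolding w_def by (rule snd) (use \<mu> \<alpha>\<beta> in auto)
    ultimately have "L (\<beta>, \<alpha> + 1) - L (\<alpha>, \<beta>)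
        = ?w * (w (subpath 0 m c2) (g \<alpha>) + w c1 (c2 m) + w (subpath m 1 c2) (g \<beta>))"
      unfolding sub Gab c1_def by (rule tele)
    then show ?thesis unfolding m(3) .
  qed
  have zg: "z \<notin> path_image g" using z inside_no_overlap by blast
  have rev: "w (linepath x y) v = - w (linepath y x) v" if "v \<notin> closed_segment x y" for x y v
    using winding_number_reversepath [of "linepath y x" v] that
    by (simp add: w_def closed_segment_commute)
  have zseg: "g \<beta> \<notin> closed_segment (g \<alpha>) z" "g \<alpha> \<notin> closed_segment z (g \<beta>)"
  proof -
    have "closed_segment (g \<alpha>) z \<inter> closed_segment z (g \<beta>) = {z}"
      by (intro Int_closed_segment disjI1 open_closed_segment zin)
    then show "g \<beta> \<notin> closed_segment (g \<alpha>) z" "g \<alpha> \<notin> closed_segment z (g \<beta>)"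
      using zin by (metis IntI ends_in_segment open_segment_def Diff_iff insertCI singletonD)+
  qed
  \<comment> \<open>\<open>c1\<close> and \<open>c2\<close> together form the curve started at
    \<open>\<alpha>\<close> instead of 0. A logarithm of \<open>?G t - z\<close> grows by the same
    amount over each period, so the starting point does not matter.\<close>
  have sum_w: "w c1 z + w c2 z = w g z"
  proof -
    obtain l where l: "continuous_on {0..2} l" "\<And>t. t \<in> {0..2} \<Longrightarrow> ?G t - z = exp (l t)"
    proof (rule continuous_logarithm_on_contractible [of "{0..2}" "\<lambda>t. ?G t - z"])
      show "continuous_on {0..2} (\<lambda>t. ?G t - z)"
        by (intro continuous_intros continuous_on_unroll)
      show "?G t - z \<noteq> 0" if "t \<in> {0..2}" for t
        using that zg by (auto simp: unroll_def path_image_def)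
    qed (auto intro: convex_imp_contractible)
    have wl: "l v - l u = ?w * w (subpath u v ?G) z" if "0 \<le> u" "u \<le> v" "v \<le> 2" for u v
      unfolding w_def
      by (rule winding_number_subpath_log_lift [where k = 1])
         (use that l(2) in \<open>auto intro: continuous_on_subset [OF l(1)]\<close>)
    have "l (\<alpha> + 1) - l \<alpha> = l (0 + 1) - l 0"
      by (rule exp_eq_imp_constant_diff [where S = "{0..1}" and k = 1])
         (use \<alpha>\<beta> l unroll_plus_one in \<open>auto intro!: continuous_intros continuous_on_compose2 [OF l(1)] simp flip: l(2)\<close>)
    moreover have "subpath 0 1 ?G t = g t" if "t \<in> {0..1}" for t
      using that by (simp add: unroll_def subpath_def)
    then have "w (subpath 0 1 ?G) z = w g z"
      unfolding w_def by (intro winding_number_cong) auto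
    ultimately have "?w * (w c1 z + w c2 z) = ?w * w g z"
      using wl [of \<alpha> \<beta>] wl [of \<beta> "\<alpha> + 1"] wl [of 0 1] \<alpha>\<beta>
      by (simp add: c1_def c2_def algebra_simps)
    then show ?thesis by (subst (asm) mult_cancel_left) auto
  qed
  \<comment> \<open>Each auxiliary segment occurs in \<open>e1\<close> and in \<open>e2\<close>,
    about the same point and in opposite directions.\<close>
  have r1: "w (linepath z (g \<alpha>)) (g \<beta>) = - w (linepath (g \<alpha>) z) (g \<beta>)"
    and r2: "w (linepath (g \<beta>) z) (g \<alpha>) = - w (linepath z (g \<beta>)) (g \<alpha>)"
    by (rule rev; use zseg in \<open>simp add: closed_segment_commute\<close>)+
  have "2 * (L (\<beta>, \<alpha> + 1) - L (\<alpha>, \<beta>)) = ?w * (w c1 z + w c2 z)"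
    using e1 e2 unfolding r1 r2 by (simp add: algebra_simps)
  then have "2 * (L (\<beta>, \<alpha> + 1) - L (\<alpha>, \<beta>)) = 2 * (of_real pi * \<i> * w g z)"
    unfolding sum_w by (simp only: mult.assoc)
  then have half: "L (\<beta>, \<alpha> + 1) - L (\<alpha>, \<beta>) = of_real pi * \<i> * w g z"
    by (subst (asm) mult_cancel_left) auto
  \<comment> \<open>The bound on the second parameter keeps the exchanged pair
    \<open>(t, s + 1)\<close> in the strip. The set is convex, so the value at
    \<open>(\<alpha>, \<beta>)\<close> is the value everywhere.\<close>
  define T where "T = {x \<in> strip. snd x \<le> 1}"
  have "T = strip \<inter> {x. (0, 1) \<bullet> x \<le> 1}" by (auto simp: T_def)
  then have "topological_space_class.connected T"
    by (simp add: convex_connected convex_Int convex_strip convex_halfspace_le)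
  have "(\<lambda>x. L (snd x, fst x + 1)) (s, t) - L (s, t) = (\<lambda>x. L (snd x, fst x + 1)) (\<alpha>, \<beta>) - L (\<alpha>, \<beta>)"
  proof (rule exp_eq_imp_constant_diff [OF \<open>topological_space_class.connected T\<close>, where k = "-1"])
    show "continuous_on T (\<lambda>x. L (snd x, fst x + 1))"
      by (rule continuous_on_compose2 [OF L]) (auto simp: T_def intro!: continuous_intros)
    show "continuous_on T L" by (rule continuous_on_subset [OF L]) (auto simp: T_def)
    show "exp (L (snd x, fst x + 1)) = - 1 * exp (L x)" if "x \<in> T" for x
    proof -
      obtain s' t' where x: "x = (s', t')" by fastforce
      have "exp (L (t', s' + 1)) = ?G (s' + 1) - ?G t'"
        using that by (intro eq [symmetric]) (auto simp: x T_def)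
      also have "?G (s' + 1) = ?G s'" using that by (intro unroll_plus_one) (auto simp: x T_def)
      also have "?G s' - ?G t' = - (?G t' - ?G s')" by simp
      also have "?G t' - ?G s' = exp (L (s', t'))"
        using that by (intro eq) (auto simp: x T_def)
      finally show ?thesis by (simp add: x)
    qed
  qed (use st \<alpha>\<beta> in \<open>auto simp: T_def\<close>)
  then show ?thesis using half by (simp add: w_def)
qed

text \<open>Two half turns in succession, by way of \<open>(t, 1)\<close>.\<close>

lemma secant_log_full_turn:
  assumes L: "continuous_on strip L"
    and eq: "\<And>s t. (s, t) \<in> strip \<Longrightarrow> unroll g t - unroll g s = exp (L (s, t))"
    and z: "z \<in> inside (path_image g)" and "0 < t" "t < 1"
  shows "L (1, t + 1) - L (0, t) = 2 * of_real pi * \<i> * winding_number g z"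
  using secant_log_half_turn [OF L eq z, of 0 t] secant_log_half_turn [OF L eq z, of t 1] assms(4,5)
  by (simp add: algebra_simps)

end

section \<open>Turning as a sum of local terms\<close>

text \<open>
  If \<open>e\<close> and \<open>f\<close> are consecutive pieces of a curve on the parameter intervals
  \<open>{a..b}\<close> and \<open>{b..c}\<close>, then \<open>turn e f\<close> is the increment of the logarithm from
  \<open>(a, b)\<close> to \<open>(b, c)\<close>.  The intermediate stops at the midpoints keep the path inside the
  strip even if \<open>f\<close> ends where \<open>e\<close> begins.
\<close>

definition turn :: "(real \<Rightarrow> complex) \<Rightarrow> (real \<Rightarrow> complex) \<Rightarrow> complex" where
  "turn e f = winding_number (subpath 0 (1/2) e) (e 1) + winding_number (subpath 0 (1/2) f) (e (1/2))
    + winding_number (subpath (1/2) 1 e) (f (1/2)) + winding_number (subpath (1/2) 1 f) (f 0)"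

lemma subpath_half:
  assumes e: "\<And>x. x \<in> {0..1} \<Longrightarrow> subpath a b g x = e x" and t: "t \<in> {0..1}"
  shows "subpath a ((a + b) / 2) g t = subpath 0 (1/2) e t"
    and "subpath ((a + b) / 2) b g t = subpath (1/2) 1 e t"
proof -
  have eq: "((a + b) / 2 - a) * t + a = (b - a) * (t / 2) + a"
    "(b - (a + b) / 2) * t + (a + b) / 2 = (b - a) * ((1 + t) / 2) + a"
    by (simp_all add: field_simps)
  have "g ((b - a) * (t / 2) + a) = e (t / 2)" "g ((b - a) * ((1 + t) / 2) + a) = e ((1 + t) / 2)"
    using e [of "t / 2", unfolded subpath_def] e [of "(1 + t) / 2", unfolded subpath_def] t by auto
  then show "subpath a ((a + b) / 2) g t = subpath 0 (1/2) e t"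
    "subpath ((a + b) / 2) b g t = subpath (1/2) 1 e t"
    unfolding subpath_def eq by (simp_all add: add_divide_distrib add.commute)
qed

text \<open>The path visits \<open>(a, b)\<close>, \<open>(m, b)\<close>, \<open>(m, m')\<close>,
  \<open>(b, m')\<close>, \<open>(b, c)\<close>, and its four segments give the four terms of
  \<open>turn\<close>. It avoids \<open>(b, b)\<close>, and also \<open>(a, c)\<close>, which is on
  the border of the strip if \<open>c = a + 1\<close>.\<close>

lemma secant_log_turn:
  assumes L: "continuous_on strip L"
    and eq: "\<And>s t. (s, t) \<in> strip \<Longrightarrow> G t - G s = exp (L (s, t))"
    and abc: "0 \<le> a" "a < b" "b \<le> 1" "b < c" "c \<le> a + 1"
    and e: "\<And>x. x \<in> {0..1} \<Longrightarrow> subpath a b G x = e x"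
    and f: "\<And>x. x \<in> {0..1} \<Longrightarrow> subpath b c G x = f x"
  shows "L (b, c) - L (a, b) = 2 * of_real pi * \<i> * turn e f"
proof -
  let ?w = "2 * of_real pi * \<i>"
  define m where "m = (a + b) / 2"
  define m' where "m' = (b + c) / 2"
  have m: "a < m" "m < b" "b < m'" "m' < c"
    using abc by (auto simp: m_def m'_def)
  have m1: "m' < m + 1"
  proof -
    have "b + c < a + b + 2" using abc by auto
    then show ?thesis by (simp add: m_def m'_def field_simps)
  qed
  have G: "G b = e 1" "G m = e (1/2)" "G m' = f (1/2)" "G b = f 0"
  proof -
    have mm: "(b - a) * (1/2) + a = m" "(c - b) * (1/2) + b = m'"
      by (simp_all add: m_def m'_def field_simps)
    show "G b = e 1" "G m = e (1/2)" "G m' = f (1/2)" "G b = f 0"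
      using e [of 1] f [of 0] e [of "1/2", unfolded subpath_def mm] f [of "1/2", unfolded subpath_def mm]
      by (auto simp: subpath_def)
  qed
  have sub: "winding_number (subpath a m G) z = winding_number (subpath 0 (1/2) e) z"
    "winding_number (subpath m b G) z = winding_number (subpath (1/2) 1 e) z"
    "winding_number (subpath b m' G) z = winding_number (subpath 0 (1/2) f) z"
    "winding_number (subpath m' c G) z = winding_number (subpath (1/2) 1 f) z" for z
    unfolding m_def m'_def
    by (rule winding_number_cong; rule subpath_half; use e f in simp)+
  note fst = secant_log_fst [OF L eq] and snd = secant_log_snd [OF L eq]
  have "L (m, b) - L (a, b) = ?w * winding_number (subpath a m G) (G b)"
    by (rule fst) (use m m1 abc in auto)
  moreover have "L (m, m') - L (m, b) = ?w * winding_number (subpath b m' G) (G m)"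
    by (rule snd) (use m m1 abc in auto)
  moreover have "L (b, m') - L (m, m') = ?w * winding_number (subpath m b G) (G m')"
    by (rule fst) (use m m1 abc in auto)
  moreover have "L (b, c) - L (b, m') = ?w * winding_number (subpath m' c G) (G b)"
    by (rule snd) (use m m1 abc in auto)
  ultimately have "(L (m, b) - L (a, b)) + (L (m, m') - L (m, b)) + (L (b, m') - L (m, m')) + (L (b, c) - L (b, m'))
      = ?w * turn e f"
    by (simp only: sub turn_def distrib_left G(2,3) G(1) [symmetric] G(4) [symmetric])
  then show ?thesis by simp
qed

lemma join_curves_Cons: "gs \<noteq> [] \<Longrightarrow> join_curves (g # gs) = g +++ join_curves gs"
  by (cases gs) auto

lemma pathstart_join_curves: "gs \<noteq> [] \<Longrightarrow> pathstart (join_curves gs) = pathstart (hd gs)"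
  by (cases gs rule: join_curves.cases) auto

lemma pathfinish_join_curves: "gs \<noteq> [] \<Longrightarrow> pathfinish (join_curves gs) = pathfinish (last gs)"
  by (induction gs rule: join_curves.induct) auto

text \<open>\<open>+++\<close> spends half of the interval on its first piece, so the breakpoints of
  the tail are halved and moved behind \<open>1/2\<close>. Each piece is an affine copy on its
  interval, as \<open>secant_log_turn\<close> requires.\<close>

lemma join_curves_breakpoints:
  assumes "gs \<noteq> []" "\<And>i. Suc i < length gs \<Longrightarrow> pathfinish (gs ! i) = pathstart (gs ! Suc i)"
  shows "\<exists>\<tau>. \<tau> 0 = 0 \<and> \<tau> (length gs) = 1 \<and> (\<forall>i<length gs. \<tau> i < \<tau> (Suc i)) \<and>
    (\<forall>i<length gs. \<forall>x\<in>{0..1}. subpath (\<tau> i) (\<tau> (Suc i)) (join_curves gs) x = (gs ! i) x)"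
  using assms
proof (induction gs rule: join_curves.induct)
  case 1
  then show ?case by simp
next
  case (2 g)
  show ?case by (intro exI [of _ real]) (auto simp: subpath_def)
next
  case (3 g h gs)
  let ?J = "join_curves (h # gs)"
  have "pathfinish ((h # gs) ! i) = pathstart ((h # gs) ! Suc i)" if "Suc i < length (h # gs)" for i
    using "3.prems"(2) [of "Suc i"] that by simp
  from "3.IH" [OF _ this] obtain \<sigma> where \<sigma>: "\<sigma> 0 = 0" "\<sigma> (length (h # gs)) = 1"
    "\<And>i. i < length (h # gs) \<Longrightarrow> \<sigma> i < \<sigma> (Suc i)"
    "\<And>i x. i < length (h # gs) \<Longrightarrow> x \<in> {0..1} \<Longrightarrow> subpath (\<sigma> i) (\<sigma> (Suc i)) ?J x = ((h # gs) ! i) x"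
    by auto
  have gJ: "g 1 = ?J 0"
    using "3.prems"(2) [of 0] pathstart_join_curves [of "h # gs"] by (simp add: pathstart_def pathfinish_def)
  \<comment> \<open>At \<open>1/2\<close> itself \<open>+++\<close> evaluates its first piece; this
    is why \<open>y = 0\<close> needs \<open>gJ\<close>.\<close>
  have join: "(g +++ ?J) (1/2 + y / 2) = ?J y" if "0 \<le> y" for y
    using that gJ by (cases "y = 0") (simp_all add: joinpaths_def)
  have \<sigma>0: "0 \<le> \<sigma> i" if "i \<le> length (h # gs)" for i
    using that
  proof (induction i)
    case (Suc i)
    then show ?case using \<sigma>(3) [of i] by simp
  qed (simp add: \<sigma>)
  define \<tau> where "\<tau> = case_nat 0 (\<lambda>i. 1/2 + \<sigma> i / 2)"
  have \<tau>: "\<tau> 0 = 0" "\<tau> (Suc i) = 1/2 + \<sigma> i / 2" for i by (simp_all add: \<tau>_def)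
  have "subpath (\<tau> i) (\<tau> (Suc i)) (g +++ ?J) x = ((g # h # gs) ! i) x"
    if i: "i < length (g # h # gs)" and x: "x \<in> {0..1}" for i x
  proof (cases i)
    case 0
    then show ?thesis using x by (auto simp: \<tau> \<sigma>(1) subpath_def joinpaths_def)
  next
    case (Suc j)
    let ?y = "(\<sigma> (Suc j) - \<sigma> j) * x + \<sigma> j"
    have j: "j < length (h # gs)" using i Suc by simp
    have "0 \<le> ?y" using \<sigma>0 [of j] \<sigma>(3) [OF j] j x by auto
    have "(\<tau> (Suc i) - \<tau> i) * x + \<tau> i = 1/2 + ?y / 2"
      by (simp add: Suc \<tau> field_simps)
    then have "subpath (\<tau> i) (\<tau> (Suc i)) (g +++ ?J) x = (g +++ ?J) (1/2 + ?y / 2)"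
      by (simp add: subpath_def)
    also have "\<dots> = ?J ?y"
      using join [OF \<open>0 \<le> ?y\<close>] .
    also have "\<dots> = ((h # gs) ! j) x"
      using \<sigma>(4) [OF j x] by (simp add: subpath_def)
    finally show ?thesis by (simp add: Suc)
  qed
  moreover have "\<tau> i < \<tau> (Suc i)" if "i < length (g # h # gs)" for i
    using that \<sigma>(3) \<sigma>(1) by (cases i) (auto simp: \<tau>)
  ultimately show ?case
    using \<sigma>(2) by (intro exI [of _ \<tau>]) (simp add: \<tau>)
qed

text \<open>With at least two pieces the pairs of neighbouring breakpoints belong to the strip. Each
  \<open>turn\<close> is the increment from one such pair to the next, and the sum telescopes to a
  full turn from \<open>(0, \<tau> 1)\<close> to \<open>(1, \<tau> 1 + 1)\<close>.\<close>

lemma sum_turn_eq_winding_number: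
  assumes n: "2 \<le> length gs"
    and chain: "\<And>i. i < length gs \<Longrightarrow> pathfinish (gs ! i) = pathstart (gs ! (Suc i mod length gs))"
    and simple: "simple_path (join_curves gs)"
    and z: "z \<in> inside (path_image (join_curves gs))"
  shows "(\<Sum>i<length gs. turn (gs ! i) (gs ! (Suc i mod length gs))) = winding_number (join_curves gs) z"
proof -
  let ?n = "length gs" and ?J = "join_curves gs" and ?w = "2 * of_real pi * \<i>"
  have "gs \<noteq> []" using n by auto
  have closed: "pathfinish ?J = pathstart ?J"
    using chain [of "?n - 1"] n \<open>gs \<noteq> []\<close>
    by (simp add: pathstart_join_curves pathfinish_join_curves hd_conv_nth last_conv_nth)
  have "pathfinish (gs ! i) = pathstart (gs ! Suc i)" if "Suc i < ?n" for i
    using chain [of i] that by simp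
  from join_curves_breakpoints [OF \<open>gs \<noteq> []\<close> this]
  obtain \<tau> where \<tau>: "\<tau> 0 = 0" "\<tau> ?n = 1" "\<And>i. i < ?n \<Longrightarrow> \<tau> i < \<tau> (Suc i)"
    "\<And>i x. i < ?n \<Longrightarrow> x \<in> {0..1} \<Longrightarrow> subpath (\<tau> i) (\<tau> (Suc i)) ?J x = (gs ! i) x"
    by auto
  have mono: "\<tau> i \<le> \<tau> j" if "i \<le> j" "j \<le> ?n" for i j
    using that
  proof (induction j)
    case (Suc j)
    then show ?case using \<tau>(3) [of j] by (cases "i = Suc j") auto
  qed simp
  obtain L where L: "continuous_on strip L"
    "\<And>s t. (s, t) \<in> strip \<Longrightarrow> unroll ?J t - unroll ?J s = exp (L (s, t))"
    using secant_log_exists [OF simple closed] by blast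
  \<comment> \<open>The last piece is followed by the first one, so one breakpoint beyond the
    closing point is needed, namely \<open>1 + \<tau> 1\<close>.\<close>
  define T where "T i = (if i \<le> ?n then \<tau> i else 1 + \<tau> (i - ?n))" for i
  have sub: "subpath (T i) (T (Suc i)) (unroll ?J) x = (gs ! (i mod ?n)) x"
    if i: "i \<le> ?n" and x: "x \<in> {0..1}" for i x
  proof (cases "i = ?n")
    case False
    let ?y = "(\<tau> (Suc i) - \<tau> i) * x + \<tau> i"
    have "(\<tau> (Suc i) - \<tau> i) * x \<le> \<tau> (Suc i) - \<tau> i"
      using x \<tau>(3) [of i] i False by (intro mult_left_le) auto
    then have "?y \<le> 1"
      using mono [of "Suc i" ?n] i False \<tau>(2) by simp
    then show ?thesis using \<tau>(4) [of i x] i False x by (simp add: T_def subpath_def unroll_def)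
  next
    case True
    let ?y = "\<tau> 1 * x"
    have "\<tau> 1 > 0" using \<tau>(1) \<tau>(3) [of 0] \<open>gs \<noteq> []\<close> by simp
    have "unroll ?J (1 + ?y) = ?J ?y"
      using mult_pos_pos [OF \<open>\<tau> 1 > 0\<close>, of x] x closed
      by (cases "x = 0") (auto simp: unroll_def pathstart_def pathfinish_def)
    then show ?thesis
      using \<tau>(4) [of 0 x] x \<tau>(1,2) \<open>gs \<noteq> []\<close> True by (simp add: T_def subpath_def add.commute)
  qed
  have "L (\<tau> (Suc i), T (Suc (Suc i))) - L (\<tau> i, T (Suc i)) = ?w * turn (gs ! i) (gs ! (Suc i mod ?n))"
    if i: "i < ?n" for i
  proof -
    have "L (T (Suc i), T (Suc (Suc i))) - L (T i, T (Suc i)) = ?w * turn (gs ! i) (gs ! (Suc i mod ?n))"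
    proof (rule secant_log_turn [OF L])
      show "0 \<le> T i" "T (Suc i) \<le> 1" "T i < T (Suc i)"
        using mono [of 0 i] mono [of "Suc i" ?n] i \<tau> by (auto simp: T_def)
      show "T (Suc i) < T (Suc (Suc i))"
        using i \<tau>(1,2) \<tau>(3) [of 0] \<tau>(3) [of "Suc i"] \<open>gs \<noteq> []\<close>
        by (cases "Suc i = ?n") (auto simp: T_def)
      show "T (Suc (Suc i)) \<le> T i + 1"
      proof (cases "Suc i = ?n")
        case True
        then show ?thesis using mono [of 1 i] n by (auto simp: T_def)
      next
        case False
        then show ?thesis using mono [of "Suc (Suc i)" ?n] mono [of 0 i] i \<tau> by (auto simp: T_def)
      qed
      show "subpath (T i) (T (Suc i)) (unroll ?J) x = (gs ! i) x" if "x \<in> {0..1}" for x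
        using sub [of i x] i that by simp
      show "subpath (T (Suc i)) (T (Suc (Suc i))) (unroll ?J) x = (gs ! (Suc i mod ?n)) x" if "x \<in> {0..1}" for x
        using sub [of "Suc i" x] i that by simp
    qed
    then show ?thesis using i by (simp add: T_def)
  qed
  then have "?w * (\<Sum>i<?n. turn (gs ! i) (gs ! (Suc i mod ?n)))
      = (\<Sum>i<?n. L (\<tau> (Suc i), T (Suc (Suc i))) - L (\<tau> i, T (Suc i)))"
    by (simp add: sum_distrib_left)
  also have "\<dots> = L (\<tau> ?n, T (Suc ?n)) - L (\<tau> 0, T (Suc 0))"
    by (rule sum_lessThan_telescope)
  also have "\<dots> = L (1, \<tau> 1 + 1) - L (0, \<tau> 1)"
    using \<tau> n by (simp add: T_def add.commute)
  also have "\<dots> = ?w * winding_number ?J z"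
  proof (rule secant_log_full_turn [OF simple closed L z])
    show "0 < \<tau> 1" "\<tau> 1 < 1"
      using \<tau>(1,2) \<tau>(3) [of 0] \<tau>(3) [of 1] mono [of 2 ?n] n \<open>gs \<noteq> []\<close> by (auto simp: numeral_2_eq_2)
  qed
  finally show ?thesis by (subst (asm) mult_cancel_left) auto
qed

section \<open>Systems of oriented arcs and loops\<close>

lemma winding_number_join_curves:
  assumes "gs \<noteq> []" "\<And>g. g \<in> set gs \<Longrightarrow> path g"
    and "successively (\<lambda>g h. pathfinish g = pathstart h) gs"
    and "\<And>g. g \<in> set gs \<Longrightarrow> z \<notin> path_image g"
  shows "path (join_curves gs) \<and> path_image (join_curves gs) = (\<Union>g\<in>set gs. path_image g) \<and>
    winding_number (join_curves gs) z = (\<Sum>g\<leftarrow>gs. winding_number g z)"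
  using assms
proof (induction gs rule: join_curves.induct)
  case (3 g h gs)
  let ?J = "join_curves (h # gs)"
  have IH: "path ?J" "path_image ?J = (\<Union>g\<in>set (h # gs). path_image g)"
    "winding_number ?J z = (\<Sum>g\<leftarrow>h # gs. winding_number g z)"
    using "3.IH" "3.prems" by auto
  have fs: "pathfinish g = pathstart ?J"
    using "3.prems"(3) by (simp add: pathstart_join_curves)
  have "z \<notin> path_image g" "z \<notin> path_image ?J" "path g"
    using "3.prems" IH by auto
  then show ?case
    using fs IH by (simp add: path_image_join winding_number_join)
qed auto

lemma union_component:
  assumes "closed X" "closed Y" "X \<inter> Y = {}" "topological_space_class.connected X" "X \<noteq> {}"
  shows "X \<in> components (X \<union> Y)"
  unfolding in_components_maximal
proof (intro conjI allI impI)
  fix D assume D: "D \<noteq> {} \<and> X \<subseteq> D \<and> D \<subseteq> X \<union> Y \<and> topological_space_class.connected D"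
  then have "Y \<inter> D = {}"
    using connected_closedD [of D X Y] assms by blast
  then show "D = X" using D by blast
qed (use assms in auto)

text \<open>A circle has no consecutive edges and enters the local formula by its orientation. A
  simple closed curve winds once around its inside, in one direction or the other, so that failure
  of the condition means -1.\<close>

definition loop_sign :: "(real \<Rightarrow> complex) \<Rightarrow> complex" where
  "loop_sign g = (if \<forall>z\<in>inside (path_image g). winding_number g z = 1 then 1 else - 1)"

lemma winding_number_eq_loop_sign:
  assumes "simple_path g" "z \<in> inside (path_image g)"
  shows "winding_number g z = loop_sign g"
  using assms by (cases rule: simple_closed_path_winding_number_inside [OF assms(1)]) (force simp: loop_sign_def)+

text \<open>A configuration after the reversal, stripped of colors and vertices; \<open>h\<close>
  carries the reversed directions. By the last three conditions every end of an arc is the start of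
  exactly one arc and the finish of exactly one, so passing to the next arc permutes
  \<open>A\<close>. Two arcs may share both end points.\<close>

locale arc_system =
  fixes A B :: "'e set" and h :: "'e \<Rightarrow> real \<Rightarrow> complex"
  assumes finite: "finite A" "finite B" and disj: "A \<inter> B = {}"
    and arc: "\<And>e. e \<in> A \<Longrightarrow> arc (h e)"
    and loop: "\<And>l. l \<in> B \<Longrightarrow> simple_path (h l)" "\<And>l. l \<in> B \<Longrightarrow> pathfinish (h l) = pathstart (h l)"
    and arc_int: "\<And>e f. e \<in> A \<Longrightarrow> f \<in> A \<Longrightarrow> e \<noteq> f \<Longrightarrow> path_image (h e) \<inter> path_image (h f)
        \<subseteq> {pathstart (h e), pathfinish (h e)} \<inter> {pathstart (h f), pathfinish (h f)}"
    and loop_int: "\<And>l e. l \<in> B \<Longrightarrow> e \<in> A \<union> B \<Longrightarrow> e \<noteq> l \<Longrightarrow> path_image (h l) \<inter> path_image (h e) = {}"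
    and inj_start: "inj_on (\<lambda>e. pathstart (h e)) A"
    and inj_finish: "inj_on (\<lambda>e. pathfinish (h e)) A"
    and ends: "(\<lambda>e. pathfinish (h e)) ` A = (\<lambda>e. pathstart (h e)) ` A"
begin

abbreviation follows :: "'e \<Rightarrow> 'e \<Rightarrow> bool" where
  "follows e f \<equiv> pathfinish (h e) = pathstart (h f)"

abbreviation im :: "'e \<Rightarrow> complex set" where
  "im e \<equiv> path_image (h e)"

definition next_arc :: "'e \<Rightarrow> 'e" where
  "next_arc e = (THE f. f \<in> A \<and> follows e f)"

definition drawing :: "complex set" where
  "drawing = (\<Union>e\<in>A \<union> B. im e)"

definition cyclic :: "'e list \<Rightarrow> bool" where
  "cyclic es \<longleftrightarrow> es \<noteq> [] \<and> distinct es \<and> set es \<subseteq> A \<and> successively follows es \<and> follows (last es) (hd es)"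

lemma next_arcI: "e \<in> A \<Longrightarrow> f \<in> A \<Longrightarrow> follows e f \<Longrightarrow> next_arc e = f"
  unfolding next_arc_def using inj_start by (intro the_equality) (auto dest: inj_onD)

lemma next_arc:
  assumes "e \<in> A"
  shows "next_arc e \<in> A" "follows e (next_arc e)"
proof -
  have "pathfinish (h e) \<in> (\<lambda>e. pathstart (h e)) ` A"
    using assms unfolding ends [symmetric] by blast
  then obtain f where "f \<in> A" "follows e f" by auto
  then show "next_arc e \<in> A" "follows e (next_arc e)"
    using next_arcI [OF assms] by auto
qed

lemma inj_next_arc: "inj_on next_arc A"
proof (rule inj_onI)
  fix e f assume ef: "e \<in> A" "f \<in> A" "next_arc e = next_arc f"
  have "pathfinish (h e) = pathfinish (h f)"
    using next_arc(2) [OF ef(1)] next_arc(2) [OF ef(2)] ef(3) by simp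
  then show "e = f" using inj_onD [OF inj_finish] ef(1,2) by blast
qed

lemma start_neq_finish: "e \<in> A \<Longrightarrow> pathstart (h e) \<noteq> pathfinish (h e)"
  using arc_distinct_ends [OF arc, of e] by metis

lemma cyclic_nth:
  assumes "cyclic es" "i < length es"
  shows "follows (es ! i) (es ! (Suc i mod length es))"
    and "next_arc (es ! i) = es ! (Suc i mod length es)"
proof -
  show f: "follows (es ! i) (es ! (Suc i mod length es))"
  proof (cases "Suc i = length es")
    case True
    then have "i = length es - 1" by simp
    then have "last es = es ! i" using assms(1) by (simp add: cyclic_def last_conv_nth)
    moreover have "hd es = es ! (Suc i mod length es)"
      using True assms(1) by (simp add: cyclic_def hd_conv_nth)
    ultimately show ?thesis using assms(1) by (simp add: cyclic_def)
  next
    case False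
    then have "Suc i < length es" using assms(2) by simp
    then show ?thesis using assms(1) by (simp add: cyclic_def successively_conv_nth)
  qed
  have "Suc i mod length es < length es" using assms(2) by (intro mod_less_divisor) auto
  then show "next_arc (es ! i) = es ! (Suc i mod length es)"
    using assms f by (intro next_arcI) (auto simp: cyclic_def subset_iff)
qed

text \<open>An arc has distinct ends and cannot follow itself. This is the bound that
  \<open>sum_turn_eq_winding_number\<close> asks for.\<close>

lemma cyclic_length:
  assumes "cyclic es"
  shows "2 \<le> length es"
proof -
  have "es \<noteq> [e]" for e
    using assms start_neq_finish [of e] by (auto simp: cyclic_def)
  moreover have "es \<noteq> []" using assms by (simp add: cyclic_def)
  ultimately show ?thesis
    by (metis One_nat_def Suc_leI Suc_lessI length_0_conv length_Suc_conv length_greater_0_conv numeral_2_eq_2)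
qed

lemma next_arc_cyclic:
  assumes "cyclic es" "e \<in> set es"
  shows "next_arc e \<in> set es"
proof -
  obtain i where "i < length es" "e = es ! i" using assms by (metis in_set_conv_nth)
  then show ?thesis
    using cyclic_nth(2) [OF assms(1)] assms(1) by (auto simp: cyclic_def)
qed

lemma previous_arc_cyclic:
  assumes "cyclic es" "f \<in> set es"
  shows "\<exists>e\<in>set es. next_arc e = f"
proof -
  have "next_arc ` set es = set es"
  proof (rule endo_inj_surj)
    show "inj_on next_arc (set es)"
      using assms(1) inj_next_arc by (auto simp: cyclic_def intro: inj_on_subset)
  qed (use next_arc_cyclic [OF assms(1)] in auto)
  then show ?thesis using assms(2) by (metis imageE)
qed

text \<open>The leading arc \<open>e\<close> is not part of the join. It occupies the start of the
  chain as its own finish, so by injectivity no later arc can finish there and the chain does not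
  close up.\<close>

lemma arc_join_chain:
  assumes "fs \<noteq> []" "distinct (e # fs)" "set (e # fs) \<subseteq> A" "successively follows (e # fs)"
  shows "arc (join_curves (map h fs)) \<and> path_image (join_curves (map h fs)) = (\<Union>f\<in>set fs. im f)"
  using assms
proof (induction fs arbitrary: e rule: induct_list012)
  case (2 f)
  then show ?case using arc by simp
next
  case (3 f g fs)
  let ?J = "join_curves (map h (g # fs))"
  have IH: "arc ?J" "path_image ?J = (\<Union>f\<in>set (g # fs). im f)"
    using "3.IH"(2) [of f] "3.prems" by auto
  have fg: "pathfinish (h f) = pathstart ?J"
    using "3.prems" by (simp add: pathstart_join_curves)
  have "im f \<inter> im k \<subseteq> {pathstart (h g)}" if "k \<in> set (g # fs)" for k
  proof -
    have k: "k \<in> A" "f \<in> A" "e \<in> A" "k \<noteq> f" "k \<noteq> e" "follows e f" "follows f g"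
      using that "3.prems" by auto
    have "pathstart (h f) \<noteq> pathstart (h k)" "pathstart (h f) \<noteq> pathfinish (h k)"
      using k inj_start inj_finish by (auto dest: inj_onD)
    then show ?thesis using arc_int [of f k] k by auto
  qed
  then have "im f \<inter> path_image ?J \<subseteq> {pathstart ?J}"
    unfolding IH(2) using fg "3.prems" by auto
  moreover have "arc (h f)" using "3.prems" arc by simp
  ultimately have "arc (h f +++ ?J)"
    using fg IH(1) by (intro arc_join) auto
  then show ?case
    using fg IH(2) by (simp add: path_image_join)
qed simp

lemma cyclic_join:
  assumes "cyclic es"
  defines "J \<equiv> join_curves (map h es)"
  shows "simple_path J" "pathfinish J = pathstart J" "path_image J = (\<Union>e\<in>set es. im e)"
proof -
  obtain e fs where es: "es = e # fs" "fs \<noteq> []"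
    using cyclic_length [OF assms(1)] by (cases es) (auto simp: Suc_le_eq)
  let ?K = "join_curves (map h fs)"
  have prems: "distinct (e # fs)" "set (e # fs) \<subseteq> A" "successively follows (e # fs)" "follows (last fs) e"
    using assms(1) by (auto simp: cyclic_def es)
  have K: "arc ?K" "path_image ?K = (\<Union>f\<in>set fs. im f)"
    using arc_join_chain [OF es(2) prems(1-3)] by auto
  have J: "J = h e +++ ?K" using es by (simp add: J_def join_curves_Cons)
  have 1: "pathfinish (h e) = pathstart ?K" "pathfinish ?K = pathstart (h e)"
    using es prems by (simp_all add: pathstart_join_curves pathfinish_join_curves hd_map last_map successively_Cons)
  show "path_image J = (\<Union>e\<in>set es. im e)" using 1 K by (simp add: J es path_image_join)
  show "pathfinish J = pathstart J" using 1 by (simp add: J)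
  have "im e \<inter> im f \<subseteq> {pathstart (h e), pathfinish (h e)}" if "f \<in> set fs" for f
    using arc_int [of e f] that prems by auto
  then have "im e \<inter> path_image ?K \<subseteq> {pathstart (h e), pathstart ?K}"
    unfolding K using 1 by auto
  then show "simple_path J" unfolding J
    using 1 K arc prems by (intro simple_path_join_loop) auto
qed

text \<open>Two decompositions of one number: the first behaves well under reversal of the arcs, the
  second is local at the vertices.\<close>

lemma cyclic_winding_number:
  assumes "cyclic es" and z: "z \<in> inside (\<Union>e\<in>set es. im e)"
  shows "winding_number (join_curves (map h es)) z = (\<Sum>e\<in>set es. winding_number (h e) z)"
    and "winding_number (join_curves (map h es)) z = (\<Sum>e\<in>set es. turn (h e) (h (next_arc e)))"
proof -
  let ?J = "join_curves (map h es)" and ?n = "length es"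
  have es: "es \<noteq> []" "distinct es" "set es \<subseteq> A" "successively follows es"
    using assms(1) by (auto simp: cyclic_def)
  have "z \<notin> (\<Union>e\<in>set es. im e)"
    using z inside_no_overlap by blast
  then have "winding_number ?J z = (\<Sum>g\<leftarrow>map h es. winding_number g z)"
    using es arc arc_imp_path
    by (intro winding_number_join_curves [THEN conjunct2, THEN conjunct2])
       (auto simp: successively_map)
  also have "\<dots> = (\<Sum>e\<leftarrow>es. winding_number (h e) z)" by (simp add: comp_def)
  also have "\<dots> = (\<Sum>e\<in>set es. winding_number (h e) z)"
    using es(2) by (simp add: sum_list_distinct_conv_sum_set)
  finally show "winding_number ?J z = (\<Sum>e\<in>set es. winding_number (h e) z)" .
  have "winding_number ?J z = (\<Sum>i<length (map h es). turn (map h es ! i) (map h es ! (Suc i mod length (map h es))))"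
  proof (rule sum_turn_eq_winding_number [symmetric])
    show "2 \<le> length (map h es)" using cyclic_length [OF assms(1)] by simp
    show "pathfinish (map h es ! i) = pathstart (map h es ! (Suc i mod length (map h es)))"
      if "i < length (map h es)" for i
      using cyclic_nth(1) [OF assms(1), of i] that es(1) by simp
    show "simple_path ?J" "z \<in> inside (path_image ?J)"
      using cyclic_join [OF assms(1)] z by auto
  qed
  also have "\<dots> = (\<Sum>i<?n. turn (h (es ! i)) (h (next_arc (es ! i))))"
    using cyclic_nth(2) [OF assms(1)] es(1) by (intro sum.cong) auto
  also have "\<dots> = (\<Sum>e\<in>set es. turn (h e) (h (next_arc e)))"
    by (rule sum.reindex_bij_betw) (use es(2) in \<open>simp add: bij_betw_nth\<close>)
  finally show "winding_number ?J z = (\<Sum>e\<in>set es. turn (h e) (h (next_arc e)))" .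
qed

lemma funpow_next_arc: "e \<in> A \<Longrightarrow> (next_arc ^^ n) e \<in> A"
  by (induction n) (auto simp: next_arc)

lemma funpow_next_arc_cancel:
  assumes "e \<in> A" "(next_arc ^^ (i + n)) e = (next_arc ^^ i) e"
  shows "(next_arc ^^ n) e = e"
  using assms
proof (induction i)
  case (Suc i)
  then have "(next_arc ^^ (i + n)) e = (next_arc ^^ i) e"
    using inj_next_arc funpow_next_arc by (auto dest!: inj_onD)
  then show ?case using Suc by blast
qed simp

text \<open>The orbit of \<open>e\<close> under an injective map of a finite set is periodic; the
  list runs through one least period.\<close>

lemma cyclic_exists:
  assumes "e \<in> A"
  obtains es where "cyclic es" "e \<in> set es"
proof -
  let ?f = "\<lambda>i. (next_arc ^^ i) e"
  have "\<not> inj ?f"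
    using finite(1) funpow_next_arc [OF assms] by (meson finite_subset image_subsetI infinite_UNIV_nat finite_imageD)
  then obtain i j where "i < j" "?f i = ?f j"
    unfolding inj_on_def by (metis linorder_neqE_nat)
  then have "?f (j - i) = e" "0 < j - i"
    using funpow_next_arc_cancel [OF assms, of i "j - i"] by auto
  then have ex: "\<exists>n. 0 < n \<and> ?f n = e" by blast
  define n where "n = (LEAST n. 0 < n \<and> ?f n = e)"
  have n: "0 < n" "?f n = e" using LeastI_ex [OF ex] by (auto simp: n_def)
  have least: "\<not> (0 < m \<and> ?f m = e)" if "m < n" for m
    using not_less_Least that by (auto simp: n_def)
  define es where "es = map ?f [0..<n]"
  have len: "length es = n" and nth: "es ! i = ?f i" if "i < n" for i using that by (simp_all add: es_def)
  have "inj_on ?f {0..<n}"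
  proof (rule linorder_inj_onI)
    fix i j assume ij: "i < j" "i \<in> {0..<n}" "j \<in> {0..<n}"
    show "?f i \<noteq> ?f j"
    proof
      assume "?f i = ?f j"
      then have "?f (j - i) = e"
        using funpow_next_arc_cancel [OF assms, of i "j - i"] ij by simp
      moreover have "j - i < n" "0 < j - i" using ij by auto
      ultimately show False using least [of "j - i"] by blast
    qed
  qed auto
  then have "distinct es" by (simp add: es_def distinct_map)
  moreover have "es \<noteq> []" using n by (simp add: es_def)
  moreover have "set es \<subseteq> A" using funpow_next_arc [OF assms] by (auto simp: es_def)
  moreover have "successively follows es"
    using next_arc(2) [OF funpow_next_arc [OF assms]] by (auto simp: successively_conv_nth es_def)
  moreover have "follows (last es) (hd es)"
  proof -
    have "last es = ?f (n - 1)" "hd es = e"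
      using n by (auto simp: es_def last_map hd_map)
    moreover have "next_arc (?f (n - 1)) = ?f n"
      using n(1) by (metis Suc_diff_1 comp_apply funpow.simps(2))
    ultimately show ?thesis
      using next_arc(2) [OF funpow_next_arc [OF assms, of "n - 1"]] n(2) by simp
  qed
  ultimately have "cyclic es" by (simp add: cyclic_def)
  moreover have "e \<in> set es" using n(1) by (force simp: es_def)
  ultimately show ?thesis using that by blast
qed

lemma im_nonempty: "im e \<noteq> {}"
  by (simp add: path_image_nonempty)

lemma path_h: "e \<in> A \<union> B \<Longrightarrow> path (h e)"
  using arc loop by (auto simp: arc_imp_path simple_path_imp_path)

text \<open>A common point of two arcs is an end of both. Since starts and finishes are injective,
  an arc that starts or finishes on the cycle coincides with an arc of the cycle.\<close>

lemma arc_notin_cyclic: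
  assumes es: "cyclic es" and f: "f \<in> A \<union> B" "f \<notin> set es" and e: "e \<in> set es"
  shows "im f \<inter> im e = {}"
proof (cases "f \<in> B")
  case True
  then show ?thesis using loop_int [of f e] e es f(2) by (auto simp: cyclic_def)
next
  case False
  then have f: "f \<in> A" "f \<notin> set es" using f by auto
  have A: "g \<in> A" if "g \<in> set es" for g using that es by (auto simp: cyclic_def)
  have "e \<noteq> f" using f e by auto
  obtain e' where e': "e' \<in> set es" "next_arc e' = e" using previous_arc_cyclic [OF es e] by blast
  have n: "next_arc e \<in> set es" using next_arc_cyclic [OF es e] .
  have "pathstart (h f) \<noteq> pathstart (h e)" "pathfinish (h f) \<noteq> pathfinish (h e)"
    "pathstart (h f) \<noteq> pathstart (h (next_arc e))" "pathfinish (h f) \<noteq> pathfinish (h e')"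
    using inj_start inj_finish f A e e' n by (metis inj_onD)+
  then have "pathstart (h f) \<noteq> pathfinish (h e)" "pathfinish (h f) \<noteq> pathstart (h e)"
    using next_arc(2) A e e' by metis+
  then show ?thesis
    using arc_int [of f e] f A e \<open>e \<noteq> f\<close> \<open>pathstart (h f) \<noteq> pathstart (h e)\<close> \<open>pathfinish (h f) \<noteq> pathfinish (h e)\<close>
    by auto
qed

text \<open>What is left outside the family is a finite union of closed sets, so no connected set
  reaches from the family across to it.\<close>

lemma component_of_closed_family:
  assumes F: "F \<subseteq> A \<union> B" "F \<noteq> {}" and conn: "topological_space_class.connected (\<Union>e\<in>F. im e)"
    and disj: "\<And>e f. e \<in> F \<Longrightarrow> f \<in> A \<union> B - F \<Longrightarrow> im f \<inter> im e = {}"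
  shows "(\<Union>e\<in>F. im e) \<in> components drawing" and "{e \<in> A \<union> B. im e \<subseteq> (\<Union>e\<in>F. im e)} = F"
proof -
  have cl: "closed (\<Union>e\<in>G. im e)" if "G \<subseteq> A \<union> B" for G
    using that finite path_h by (intro closed_UN) (auto intro: finite_subset simp: closed_path_image)
  have "(\<Union>e\<in>F. im e) \<in> components ((\<Union>e\<in>F. im e) \<union> (\<Union>e\<in>A \<union> B - F. im e))"
    using F disj conn im_nonempty by (intro union_component cl) auto
  also have "(\<Union>e\<in>F. im e) \<union> (\<Union>e\<in>A \<union> B - F. im e) = drawing"
    using F by (auto simp: drawing_def)
  finally show "(\<Union>e\<in>F. im e) \<in> components drawing" .
  show "{e \<in> A \<union> B. im e \<subseteq> (\<Union>e\<in>F. im e)} = F"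
  proof (intro equalityI subsetI)
    fix e assume e: "e \<in> {e \<in> A \<union> B. im e \<subseteq> (\<Union>e\<in>F. im e)}"
    show "e \<in> F"
    proof (rule ccontr)
      assume "e \<notin> F"
      then have "im e \<inter> (\<Union>e\<in>F. im e) = {}" using disj e by blast
      then show False using e im_nonempty by blast
    qed
  qed (use F in auto)
qed

lemma cyclic_component:
  assumes "cyclic es"
  shows "(\<Union>e\<in>set es. im e) \<in> components drawing"
    and "{e \<in> A \<union> B. im e \<subseteq> (\<Union>e\<in>set es. im e)} = set es"
proof -
  have "topological_space_class.connected (\<Union>e\<in>set es. im e)"
    using cyclic_join [OF assms] connected_simple_path_image by metis
  moreover have "set es \<subseteq> A \<union> B" "set es \<noteq> {}" using assms by (auto simp: cyclic_def)
  ultimately show "(\<Union>e\<in>set es. im e) \<in> components drawing"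
    "{e \<in> A \<union> B. im e \<subseteq> (\<Union>e\<in>set es. im e)} = set es"
    using component_of_closed_family [of "set es"] arc_notin_cyclic [OF assms] by blast+
qed

lemma loop_component:
  assumes "l \<in> B"
  shows "im l \<in> components drawing" and "{e \<in> A \<union> B. im e \<subseteq> im l} = {l}"
proof -
  have "topological_space_class.connected (\<Union>e\<in>{l}. im e)"
    using loop(1) [OF assms] by (simp add: connected_simple_path_image)
  moreover have "im f \<inter> im e = {}" if "e \<in> {l}" "f \<in> A \<union> B - {l}" for e f
    using loop_int [OF assms, of f] that by blast
  ultimately have "(\<Union>e\<in>{l}. im e) \<in> components drawing \<and> {e \<in> A \<union> B. im e \<subseteq> (\<Union>e\<in>{l}. im e)} = {l}"
    using component_of_closed_family [of "{l}"] assms by blast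
  then show "im l \<in> components drawing" "{e \<in> A \<union> B. im e \<subseteq> im l} = {l}"
    by simp_all
qed

lemma component_cases:
  assumes K: "K \<in> components drawing"
  obtains (loop) l where "l \<in> B" "K = im l" "{e \<in> A \<union> B. im e \<subseteq> K} = {l}"
  | (cycle) es where "cyclic es" "K = (\<Union>e\<in>set es. im e)" "{e \<in> A \<union> B. im e \<subseteq> K} = set es"
proof -
  obtain x where "x \<in> K" "x \<in> drawing"
    using K in_components_nonempty in_components_subset by blast
  then obtain e where e: "e \<in> A \<union> B" "x \<in> im e" by (auto simp: drawing_def)
  show ?thesis
  proof (cases "e \<in> B")
    case True
    then have "K = im e"
      using components_eq [OF K loop_component(1) [OF True]] e(2) \<open>x \<in> K\<close> by blast
    then show ?thesis using that(1) [OF True] loop_component(2) [OF True] by simp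
  next
    case False
    then obtain es where es: "cyclic es" "e \<in> set es" using cyclic_exists e by blast
    then have "K = (\<Union>e\<in>set es. im e)"
      using components_eq [OF K cyclic_component(1) [OF es(1)]] e(2) \<open>x \<in> K\<close> by blast
    then show ?thesis using that(2) [OF es(1)] cyclic_component(2) [OF es(1)] by simp
  qed
qed

end

section \<open>Signs of components, from local terms and from winding numbers\<close>

context arc_system
begin

definition local_sum :: "complex set \<Rightarrow> complex" where
  "local_sum K = (\<Sum>l | l \<in> B \<and> im l \<subseteq> K. loop_sign (h l))
    + (\<Sum>e | e \<in> A \<and> im e \<subseteq> K. turn (h e) (h (next_arc e)))"

text \<open>For a component the windings of the single arcs add up to that of a closed curve,
  without any enumeration of the cycle. Each summand changes sign if its arc is reversed, provided
  \<open>z\<close> is off the arc, which makes this form suitable for the exchange on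
  \<open>C\<close>.\<close>

definition index :: "complex set \<Rightarrow> complex \<Rightarrow> complex" where
  "index K z = (\<Sum>e | e \<in> A \<union> B \<and> im e \<subseteq> K. winding_number (h e) z)"

text \<open>Circles and cycles of arcs are brought under one roof: the signs below only use that a
  component is the image of some simple closed \<open>g\<close>.\<close>

lemma component_loop:
  assumes K: "K \<in> components drawing"
  obtains g where "simple_path g" "pathfinish g = pathstart g" "path_image g = K"
    "\<And>z. z \<in> inside K \<Longrightarrow> index K z = winding_number g z"
    "\<And>z. z \<in> inside K \<Longrightarrow> local_sum K = winding_number g z"
proof -
  have split: "{k. k \<in> B \<and> im k \<subseteq> K} = {e \<in> A \<union> B. im e \<subseteq> K} \<inter> B"
    "{e. e \<in> A \<and> im e \<subseteq> K} = {e \<in> A \<union> B. im e \<subseteq> K} \<inter> A"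
    by auto
  from K show ?thesis
  proof (cases rule: component_cases)
    case (loop l)
    have sets: "{k. k \<in> B \<and> im k \<subseteq> K} = {l}" "{e. e \<in> A \<and> im e \<subseteq> K} = {}"
      using loop(1) disj unfolding split loop(3) by auto
    have "local_sum K = loop_sign (h l)" unfolding local_sum_def sets by simp
    moreover have "index K z = winding_number (h l) z" for z
      using loop(3) by (simp add: index_def)
    moreover have "simple_path (h l)" "pathfinish (h l) = pathstart (h l)"
      using loop(1) arc_system.loop [OF arc_system_axioms] by blast+
    ultimately show ?thesis
      using loop(2) winding_number_eq_loop_sign [of "h l"] by (intro that [of "h l"]) auto
  next
    case (cycle es)
    have sets: "{k. k \<in> B \<and> im k \<subseteq> K} = {}" "{e. e \<in> A \<and> im e \<subseteq> K} = set es"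
      using cycle(1) disj unfolding split cycle(3) cyclic_def by auto
    have "local_sum K = (\<Sum>e\<in>set es. turn (h e) (h (next_arc e)))"
      unfolding local_sum_def sets by simp
    moreover have "index K z = (\<Sum>e\<in>set es. winding_number (h e) z)" for z
      using cycle(3) by (simp add: index_def)
    moreover have "path_image (join_curves (map h es)) = K"
      using cyclic_join(3) [OF cycle(1)] cycle(2) by simp
    moreover have "winding_number (join_curves (map h es)) z = (\<Sum>e\<in>set es. winding_number (h e) z)"
      "winding_number (join_curves (map h es)) z = (\<Sum>e\<in>set es. turn (h e) (h (next_arc e)))"
      if "z \<in> inside K" for z
      using cyclic_winding_number [OF cycle(1)] that cycle(2) by blast+
    ultimately show ?thesis
      using cyclic_join(1,2) [OF cycle(1)] by (intro that [of "join_curves (map h es)"]) auto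
  qed
qed

lemma inside_component_nonempty:
  assumes "K \<in> components drawing"
  shows "inside K \<noteq> {}"
proof -
  obtain g where "simple_path g" "pathfinish g = pathstart g" "path_image g = K"
    by (rule component_loop [OF assms]) (rule that)
  then show ?thesis using Jordan_inside_outside [of g] by simp
qed

lemma component_sign:
  assumes K: "K \<in> components drawing"
  shows "(\<forall>z\<in>inside K. index K z = 1) \<and> local_sum K = 1 \<or> (\<forall>z\<in>inside K. index K z = - 1) \<and> local_sum K = - 1"
proof -
  obtain g where g: "simple_path g" "pathfinish g = pathstart g" "path_image g = K"
    "\<And>z. z \<in> inside K \<Longrightarrow> index K z = winding_number g z"
    "\<And>z. z \<in> inside K \<Longrightarrow> local_sum K = winding_number g z"
    by (rule component_loop [OF K]) (rule that)
  obtain z where z: "z \<in> inside K" using inside_component_nonempty [OF K] by blast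
  from simple_closed_path_winding_number_inside [OF g(1)] show ?thesis
  proof cases
    case 1
    then show ?thesis using g(3-5) z by auto
  next
    case 2
    then show ?thesis using g(3-5) z by auto
  qed
qed

lemma local_sum_eq_index:
  assumes "K \<in> components drawing" "z \<in> inside K"
  shows "local_sum K = index K z"
  by (rule component_loop [OF assms(1)]) (use assms(2) in simp)

lemma component_contains:
  assumes "K \<in> components drawing"
  obtains e where "e \<in> A \<union> B" "im e \<subseteq> K"
  using assms
proof (cases rule: component_cases)
  case (loop l)
  then show ?thesis using that [of l] by simp
next
  case (cycle es)
  then have "hd es \<in> {e \<in> A \<union> B. im e \<subseteq> K}" by (simp add: cyclic_def)
  then show ?thesis using that [of "hd es"] by simp
qed

lemma component_unique:
  assumes "K \<in> components drawing" "K' \<in> components drawing" "im e \<subseteq> K" "im e \<subseteq> K'"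
  shows "K' = K"
proof -
  have "K \<inter> K' \<noteq> {}" using assms(3,4) im_nonempty [of e] by auto
  then show ?thesis using components_eq [OF assms(1,2)] by simp
qed

lemma im_component:
  assumes "e \<in> A \<union> B"
  obtains K where "K \<in> components drawing" "im e \<subseteq> K"
proof -
  have sub: "im e \<subseteq> drawing" using assms by (auto simp: drawing_def)
  have con: "topological_space_class.connected (im e)"
    using path_h [OF assms] by (simp add: connected_path_image)
  have "drawing \<noteq> {}" using sub im_nonempty [of e] by auto
  then show ?thesis
    using exists_component_superset [OF sub _ con] that by auto
qed

lemma finite_components: "finite (components drawing)"
proof (rule finite_surj)
  show "finite (A \<union> B)" using finite by simp
  show "components drawing \<subseteq> (\<lambda>e. THE K. K \<in> components drawing \<and> im e \<subseteq> K) ` (A \<union> B)"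
  proof
    fix K assume K: "K \<in> components drawing"
    obtain e where e: "e \<in> A \<union> B" "im e \<subseteq> K"
      by (rule component_contains [OF K]) (rule that)
    have "(THE K. K \<in> components drawing \<and> im e \<subseteq> K) = K"
      using K e(2) component_unique [OF K] by (intro the_equality) auto
    then show "K \<in> (\<lambda>e. THE K. K \<in> components drawing \<and> im e \<subseteq> K) ` (A \<union> B)"
      using e(1) by (intro image_eqI [of _ _ e]) simp_all
  qed
qed

lemma sum_over_components:
  fixes f :: "'e \<Rightarrow> complex"
  assumes "F \<subseteq> A \<union> B"
  shows "(\<Sum>K\<in>components drawing. \<Sum>e | e \<in> F \<and> im e \<subseteq> K. f e) = (\<Sum>e\<in>F. f e)"
proof -
  have F: "finite F" using assms finite by (auto intro: finite_subset)
  have "(\<Sum>K\<in>components drawing. \<Sum>e | e \<in> F \<and> im e \<subseteq> K. f e)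
      = (\<Sum>K\<in>components drawing. \<Sum>e\<in>F. if im e \<subseteq> K then f e else 0)"
    by (simp only: sum.inter_filter [OF F])
  also have "\<dots> = (\<Sum>e\<in>F. \<Sum>K\<in>components drawing. if im e \<subseteq> K then f e else 0)"
    by (rule sum.swap)
  also have "\<dots> = (\<Sum>e\<in>F. f e)"
  proof (rule sum.cong [OF refl])
    fix e assume "e \<in> F"
    then have "e \<in> A \<union> B" using assms by blast
    then obtain K where K: "K \<in> components drawing" "im e \<subseteq> K"
      using im_component by metis
    have "(\<Sum>K'\<in>components drawing. if im e \<subseteq> K' then f e else 0)
        = (\<Sum>K'\<in>components drawing. if K' = K then f e else 0)"
    proof (rule sum.cong [OF refl])
      fix K' assume "K' \<in> components drawing"
      then have "im e \<subseteq> K' \<longleftrightarrow> K' = K" using K component_unique [of K K' e] by auto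
      then show "(if im e \<subseteq> K' then f e else 0) = (if K' = K then f e else 0)" by simp
    qed
    then show "(\<Sum>K\<in>components drawing. if im e \<subseteq> K then f e else 0) = f e"
      using K finite_components by simp
  qed
  finally show ?thesis .
qed

text \<open>\<open>next_arc\<close> depends on the configuration as a whole. The set of pairs with
  \<open>follows\<close> is its graph, and a sum over pairs can be compared between different
  configurations.\<close>

lemma sum_local_sum:
  "(\<Sum>K\<in>components drawing. local_sum K)
    = (\<Sum>l\<in>B. loop_sign (h l)) + (\<Sum>(e, f) | e \<in> A \<and> f \<in> A \<and> follows e f. turn (h e) (h f))"
proof -
  have eq: "{(e, f). e \<in> A \<and> f \<in> A \<and> follows e f} = (\<lambda>e. (e, next_arc e)) ` A"
  proof (intro equalityI subsetI)
    fix x assume "x \<in> {(e, f). e \<in> A \<and> f \<in> A \<and> follows e f}"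
    then have x: "fst x \<in> A" "next_arc (fst x) = snd x" using next_arcI by auto
    then show "x \<in> (\<lambda>e. (e, next_arc e)) ` A"
      by (intro image_eqI [of _ _ "fst x"]) simp_all
  qed (use next_arc in auto)
  have "(\<Sum>(e, f) | e \<in> A \<and> f \<in> A \<and> follows e f. turn (h e) (h f)) = (\<Sum>e\<in>A. turn (h e) (h (next_arc e)))"
    unfolding eq by (subst sum.reindex) (auto simp: inj_on_def)
  then show ?thesis
    by (simp add: local_sum_def sum.distrib sum_over_components)
qed

end

section \<open>Oriented cycles of a plane configuration and its degree\<close>

lemma cas_conv_successively:
  "p \<noteq> [] \<Longrightarrow> pre_digraph.cas G u p v \<longleftrightarrow>
    tail G (hd p) = u \<and> successively (\<lambda>e f. head G e = tail G f) p \<and> head G (last p) = v"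
proof (induction p arbitrary: u)
  case (Cons e p)
  show ?case
  proof (cases "p = []")
    case True
    then show ?thesis by (simp add: pre_digraph.cas.simps)
  next
    case False
    have "pre_digraph.cas G u (e # p) v \<longleftrightarrow> tail G e = u \<and> pre_digraph.cas G (head G e) p v"
      by (rule pre_digraph.cas.simps)
    also have "\<dots> \<longleftrightarrow> tail G e = u \<and> tail G (hd p) = head G e
        \<and> successively (\<lambda>e f. head G e = tail G f) p \<and> head G (last p) = v"
      using Cons.IH [OF False] by blast
    also have "\<dots> \<longleftrightarrow> tail G e = u \<and> successively (\<lambda>e f. head G e = tail G f) (e # p) \<and> head G (last p) = v"
      using False unfolding successively_Cons by metis
    finally show ?thesis using False by simp
  qed
qed simp

text \<open>\<open>pre_digraph.cycle\<close> asks for distinct vertices and \<open>cyclic\<close>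
  for distinct arcs. The two agree because different arcs have different heads.\<close>

lemma (in arc_system) cycle_iff_cyclic:
  assumes G: "arcs G \<subseteq> A" "set es \<subseteq> arcs G"
    "\<And>e. e \<in> arcs G \<Longrightarrow> tail G e = pathstart (h e) \<and> head G e = pathfinish (h e) \<and> tail G e \<in> verts G"
  shows "pre_digraph.cycle G es \<longleftrightarrow> cyclic es"
proof (cases "es = []")
  case False
  have succ: "successively (\<lambda>e f. head G e = tail G f) es \<longleftrightarrow> successively follows es"
  proof (rule successively_cong)
    fix e f assume "e \<in> set es" "f \<in> set es"
    then have "e \<in> arcs G" "f \<in> arcs G" using G(2) by auto
    then show "head G e = tail G f \<longleftrightarrow> follows e f" using G(3) [of e] G(3) [of f] by simp
  qed simp
  have hl: "hd es \<in> arcs G" "last es \<in> arcs G" using G(2) False by auto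
  have dist: "distinct (List.tl (pre_digraph.awalk_verts G u es)) \<longleftrightarrow> distinct es" if "pre_digraph.cas G u es u" for u
  proof -
    have "List.tl (pre_digraph.awalk_verts G u es) = map (head G) es"
      using pre_digraph.awalk_verts_conv' [OF that] False by simp
    moreover have "inj_on (head G) (set es)"
    proof (rule inj_onI)
      fix e f assume ef: "e \<in> set es" "f \<in> set es" "head G e = head G f"
      then have "e \<in> arcs G" "f \<in> arcs G" using G(2) by auto
      then show "e = f" using inj_onD [OF inj_finish, of e f] ef(3) G(1) G(3) [of e] G(3) [of f] by auto
    qed
    ultimately show ?thesis by (simp add: distinct_map)
  qed
  have cas: "pre_digraph.cas G u es u \<longleftrightarrow>
      pathstart (h (hd es)) = u \<and> successively follows es \<and> pathfinish (h (last es)) = u" for u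
    using cas_conv_successively [OF False, of G u u] succ G(3) [OF hl(1)] G(3) [OF hl(2)] by simp
  show ?thesis
  proof
    assume "pre_digraph.cycle G es"
    then obtain u where "pre_digraph.cas G u es u" "distinct (List.tl (pre_digraph.awalk_verts G u es))"
      unfolding pre_digraph.cycle_def pre_digraph.awalk_def by auto
    then show "cyclic es"
      using dist cas False G(1,2) unfolding cyclic_def by auto
  next
    assume c: "cyclic es"
    then have "pre_digraph.cas G (pathstart (h (hd es))) es (pathstart (h (hd es)))"
      using cas unfolding cyclic_def by simp
    then show "pre_digraph.cycle G es"
      unfolding pre_digraph.cycle_def pre_digraph.awalk_def
      using dist c False G(2) G(3) [OF hl(1)] by (intro exI [of _ "pathstart (h (hd es))"]) (auto simp: cyclic_def)
  qed
qed (simp add: pre_digraph.cycle_def cyclic_def)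

text \<open>\<open>R\<close> is the set of reversed edges. \<open>verts_eq\<close> excludes isolated
  vertices, so that the support consists of the curves alone and has the components known from
  \<open>arc_system\<close>.\<close>

locale oriented_configuration =
  arc_system "arcs (digraph_of D)" "circles D" "curve (reverse_edges R D)"
  for D :: "'e plane_graph" and R :: "'e set" +
  assumes curve_ends: "\<And>e. e \<in> arcs (digraph_of D) \<Longrightarrow>
      tail (digraph_of D) e = pathstart (curve D e) \<and> head (digraph_of D) e = pathfinish (curve D e)"
    and verts_eq: "verts (digraph_of D) = (\<lambda>e. pathstart (curve (reverse_edges R D) e)) ` arcs (digraph_of D)"
begin

lemma im_eq: "im e = path_image (curve D e)"
  by (simp add: reverse_edges_def)

lemma support_eq: "support D = drawing"
proof -
  have "verts (digraph_of D) \<subseteq> drawing"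
    unfolding verts_eq drawing_def using pathstart_in_path_image by blast
  then show ?thesis
    by (auto simp: support_def drawing_def edges_and_circles_def im_eq)
qed

text \<open>The definition asks for some enumeration of the edges of a cycle. \<open>index\<close>
  refers to none, so every enumeration gives the same answer, and one exists.\<close>

lemma counterclockwise_cycle_iff:
  assumes K: "K \<in> components drawing"
  shows "counterclockwise_cycle (reverse_edges R (restrict_to D K)) \<longleftrightarrow> (\<forall>z\<in>inside K. index K z = 1)"
proof -
  let ?C = "reverse_edges R (restrict_to D K)" and ?h = "curve (reverse_edges R D)"
  define F where "F = {e. e \<in> arcs (digraph_of D) \<union> circles D \<and> im e \<subseteq> K}"
  have C: "arcs (digraph_of ?C) = arcs (digraph_of D) \<inter> F" "circles ?C = circles D \<inter> F" "curve ?C = ?h"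
    by (auto simp: F_def reverse_edges_def restrict_to_def im_eq)
  have ix: "index K z = (\<Sum>e\<in>F. winding_number (?h e) z)" for z
    by (simp add: index_def F_def)
  from K show ?thesis
  proof (cases rule: component_cases)
    case (loop l)
    have "F = {l}" using loop(3) by (simp add: F_def)
    then have 1: "arcs (digraph_of ?C) = {}" "circles ?C = {l}"
      using loop disj C by auto
    have "simple_path (?h l)" "pathfinish (?h l) = pathstart (?h l)"
      using loop(1) arc_system.loop [OF arc_system_axioms] by blast+
    moreover have "index K z = winding_number (?h l) z" for z
      by (simp add: ix \<open>F = {l}\<close>)
    ultimately have "counterclockwise_curve (?h l) \<longleftrightarrow> (\<forall>z\<in>inside K. index K z = 1)"
      unfolding counterclockwise_curve_def loop(2) [symmetric] by simp
    then show ?thesis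
      unfolding counterclockwise_cycle_def 1 C(3) by simp
  next
    case (cycle es)
    have "F = set es" using cycle(3) by (simp add: F_def)
    moreover have "set es \<subseteq> arcs (digraph_of D)" "set es \<noteq> {}" using cycle(1) by (auto simp: cyclic_def)
    ultimately have 1: "arcs (digraph_of ?C) = set es" "circles ?C = {}"
      using disj C by auto
    have G: "tail (digraph_of ?C) e = pathstart (?h e) \<and> head (digraph_of ?C) e = pathfinish (?h e)
        \<and> tail (digraph_of ?C) e \<in> verts (digraph_of ?C)" if e: "e \<in> arcs (digraph_of ?C)" for e
    proof -
      have eD: "e \<in> arcs (digraph_of D)" "e \<in> F" using e C by auto
      have t: "tail (digraph_of ?C) e = pathstart (?h e)" "head (digraph_of ?C) e = pathfinish (?h e)"
        using curve_ends [OF eD(1)] by (auto simp: reverse_edges_def restrict_to_def)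
      have "pathstart (?h e) \<in> verts (digraph_of D) \<inter> K"
        using eD pathstart_in_path_image [of "?h e"] unfolding verts_eq F_def by blast
      also have "verts (digraph_of D) \<inter> K = verts (digraph_of ?C)"
        by (simp add: reverse_edges_def restrict_to_def)
      finally show ?thesis using t by simp
    qed
    have cyc: "pre_digraph.cycle (digraph_of ?C) fs \<longleftrightarrow> cyclic fs" if "set fs = set es" for fs
    proof (rule cycle_iff_cyclic [OF _ _ G])
      show "arcs (digraph_of ?C) \<subseteq> arcs (digraph_of D)" unfolding C(1) by blast
      show "set fs \<subseteq> arcs (digraph_of ?C)" using 1 that by simp
    qed
    have ccw: "counterclockwise_curve (join_curves (map ?h fs)) \<longleftrightarrow> (\<forall>z\<in>inside K. index K z = 1)"
      if fs: "cyclic fs" "set fs = set es" for fs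
    proof -
      let ?J = "join_curves (map ?h fs)"
      have "path_image ?J = K" using cyclic_join(3) [OF fs(1)] fs(2) cycle(2) by simp
      moreover have "winding_number ?J z = index K z" if "z \<in> inside K" for z
        using cyclic_winding_number(1) [OF fs(1), of z] that fs(2) cycle(2) ix \<open>F = set es\<close> by simp
      ultimately show ?thesis
        using cyclic_join(1,2) [OF fs(1)] by (simp add: counterclockwise_curve_def)
    qed
    have "counterclockwise_cycle ?C \<longleftrightarrow>
        (\<exists>fs. pre_digraph.cycle (digraph_of ?C) fs \<and> set fs = set es \<and> counterclockwise_curve (join_curves (map ?h fs)))"
      unfolding counterclockwise_cycle_def 1 C(3) using \<open>set es \<noteq> {}\<close> by simp
    also have "\<dots> \<longleftrightarrow> (\<exists>fs. cyclic fs \<and> set fs = set es \<and> (\<forall>z\<in>inside K. index K z = 1))"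
      using cyc ccw by (intro ex_cong1) metis
    finally show ?thesis using cycle(1) by blast
  qed
qed

text \<open>Every component contains an edge or circle that lies in no other one. The degree counts
  graphs and can thus be computed by counting components.\<close>

lemma inj_restrict_to: "inj_on (restrict_to D) (components drawing)"
proof (rule inj_onI)
  fix K K' assume K: "K \<in> components drawing" "K' \<in> components drawing" "restrict_to D K = restrict_to D K'"
  obtain e where e: "e \<in> arcs (digraph_of D) \<union> circles D" "im e \<subseteq> K"
    by (rule component_contains [OF K(1)]) (rule that)
  have mem: "e \<in> arcs (digraph_of (restrict_to D X)) \<union> circles (restrict_to D X) \<longleftrightarrow> im e \<subseteq> X" for X
    using e(1) unfolding im_eq by (simp add: restrict_to_def) blast
  have "im e \<subseteq> K'" using e(2) unfolding mem [symmetric] K(3) .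
  then show "K = K'" using component_unique [OF K(2,1)] e(2) by simp
qed

lemma local_sum_sign:
  assumes R: "R = {e. c e = Max (colors_without u)}" and K: "K \<in> components drawing"
  shows "local_sum K = (if positively_oriented u c (restrict_to D K) then 1 else - 1)"
proof -
  have pos: "positively_oriented u c (restrict_to D K) \<longleftrightarrow> (\<forall>z\<in>inside K. index K z = 1)"
    using counterclockwise_cycle_iff [OF K] by (simp add: positively_oriented_def R)
  obtain z where z: "z \<in> inside K" using inside_component_nonempty [OF K] by auto
  from component_sign [OF K] show ?thesis
  proof
    assume "(\<forall>z\<in>inside K. index K z = 1) \<and> local_sum K = 1"
    then show ?thesis using pos by simp
  next
    assume *: "(\<forall>z\<in>inside K. index K z = - 1) \<and> local_sum K = - 1"
    then have "index K z \<noteq> 1" using z by simp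
    then have "\<not> positively_oriented u c (restrict_to D K)" using pos z by blast
    then show ?thesis using * by simp
  qed
qed

lemma config_degree_eq:
  assumes R: "R = {e. c e = Max (colors_without u)}"
  shows "of_int (config_degree u c D) = (\<Sum>K\<in>components drawing. local_sum K)"
proof -
  let ?P = "\<lambda>K. positively_oriented u c (restrict_to D K)"
  have card: "card {C \<in> component_graphs D. Q C} = card {K \<in> components drawing. Q (restrict_to D K)}" for Q
  proof -
    have "{C \<in> component_graphs D. Q C} = restrict_to D ` {K \<in> components drawing. Q (restrict_to D K)}"
      by (auto simp: component_graphs_def support_eq)
    moreover have "inj_on (restrict_to D) {K \<in> components drawing. Q (restrict_to D K)}"
      by (rule inj_on_subset [OF inj_restrict_to]) auto
    ultimately show ?thesis by (simp add: card_image)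
  qed
  have "(\<Sum>K\<in>components drawing. local_sum K) = (\<Sum>K\<in>components drawing. if ?P K then 1 else - 1)"
    by (intro sum.cong refl local_sum_sign [OF R])
  also have "\<dots> = of_nat (card (components drawing \<inter> {K. ?P K})) - of_nat (card (components drawing \<inter> - {K. ?P K}))"
    by (subst sum.If_cases [OF finite_components]) simp
  also have "components drawing \<inter> {K. ?P K} = {K \<in> components drawing. ?P K}" by auto
  also have "components drawing \<inter> - {K. ?P K} = {K \<in> components drawing. \<not> ?P K}"
    by auto
  also have "of_nat (card {K \<in> components drawing. ?P K}) - of_nat (card {K \<in> components drawing. \<not> ?P K})
      = of_int (config_degree u c D)"
    unfolding config_degree_def card negatively_oriented_def by simp
  finally show ?thesis by simp
qed

end

section \<open>Colored webs\<close>

lemma UNIV_color: "UNIV = {Red, Green, Blue}"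
  using color.exhaust by auto

lemma colors_without_eq:
  "colors_without Red = {Green, Blue}" "colors_without Green = {Red, Blue}" "colors_without Blue = {Red, Green}"
  unfolding UNIV_color by auto

lemma Max_colors_without [simp]:
  "Max (colors_without Red) = Blue" "Max (colors_without Green) = Blue" "Max (colors_without Blue) = Green"
  unfolding colors_without_eq by (simp_all add: max_def less_eq_color_def)

lemma Min_colors_without [simp]:
  "Min (colors_without Red) = Green" "Min (colors_without Green) = Red" "Min (colors_without Blue) = Red"
  unfolding colors_without_eq by (simp_all add: min_def less_eq_color_def)

lemma Max_colors_without_neq: "Max (colors_without u) \<noteq> u"
  by (cases u) simp_all

lemma color_eq_MinI: "x \<noteq> u \<Longrightarrow> x \<noteq> Max (colors_without u) \<Longrightarrow> x = Min (colors_without u)"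
  by (cases u; cases x) simp_all

lemma Min_colors_without_neq: "Min (colors_without u) \<noteq> u" "Min (colors_without u) \<noteq> Max (colors_without u)"
  by (cases u; simp)+

locale colored_web =
  fixes w :: "'e plane_graph" and c :: "'e \<Rightarrow> color"
  assumes web: "closed_web w" and col: "coloring w c"
begin

abbreviation "G \<equiv> digraph_of w"

definition incident :: "complex \<Rightarrow> 'e set" where
  "incident v = {e \<in> arcs G. tail G e = v \<or> head G e = v}"

lemma fin: "finite (arcs G)" "finite (circles w)" "arcs G \<inter> circles w = {}"
  using web by (auto simp: closed_web_def intro: fin_digraph.finite_arcs)

lemma embedded: "smoothly_embedded w"
  using web by (simp add: closed_web_def)

lemma ends_in_verts: "e \<in> arcs G \<Longrightarrow> tail G e \<in> verts G" "e \<in> arcs G \<Longrightarrow> head G e \<in> verts G"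
proof -
  have "wf_digraph G" using web by (simp add: closed_web_def fin_digraph_def)
  then show "e \<in> arcs G \<Longrightarrow> tail G e \<in> verts G" "e \<in> arcs G \<Longrightarrow> head G e \<in> verts G"
    by (simp_all add: wf_digraph_def)
qed

lemma source_or_sink:
  assumes "v \<in> verts G"
  shows "(\<forall>e\<in>incident v. tail G e = v \<and> head G e \<noteq> v) \<or> (\<forall>e\<in>incident v. head G e = v \<and> tail G e \<noteq> v)"
proof -
  have "in_arcs G v = {} \<or> out_arcs G v = {}"
    using web assms by (simp add: closed_web_def)
  then show ?thesis by (auto simp: incident_def in_arcs_def out_arcs_def)
qed

lemma tail_neq_head: "e \<in> arcs G \<Longrightarrow> tail G e \<noteq> head G e"
  using source_or_sink [OF ends_in_verts(1), of e] by (auto simp: incident_def)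

lemma inj_color_incident: "inj_on c (incident v)"
proof (rule inj_onI, rule ccontr)
  fix e f assume *: "e \<in> incident v" "f \<in> incident v" "c e = c f" "e \<noteq> f"
  then have "adjacent_edges w e f" by (auto simp: adjacent_edges_def incident_def)
  then show False using col * by (simp add: coloring_def)
qed

text \<open>Three edges with different colors exhaust the colors. They really are three, since an
  edge counted twice would both enter and leave \<open>v\<close>.\<close>

lemma incident_color_exists:
  assumes v: "v \<in> verts G"
  obtains e where "e \<in> incident v" "c e = x"
proof -
  have "incident v = in_arcs G v \<union> out_arcs G v"
    by (auto simp: incident_def in_arcs_def out_arcs_def)
  moreover have "in_arcs G v = {} \<or> out_arcs G v = {}" "card (in_arcs G v) + card (out_arcs G v) = 3"
    using web v by (auto simp: closed_web_def in_degree_def out_degree_def)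
  ultimately have "card (incident v) = 3" by auto
  then have "card (c ` incident v) = card (UNIV :: color set)"
    using inj_color_incident by (simp add: card_image UNIV_color)
  then have "c ` incident v = UNIV" by (intro card_subset_eq) auto
  then have "x \<in> c ` incident v" by simp
  then show ?thesis using that by blast
qed

lemma curve_arc:
  assumes "e \<in> arcs G"
  shows "simple_path (curve w e)" "pathstart (curve w e) = tail G e" "pathfinish (curve w e) = head G e"
    "arc (curve w e)"
  using assms embedded tail_neq_head [OF assms] by (auto simp: smoothly_embedded_def simple_path_imp_arc)

lemma curve_circle:
  assumes "l \<in> circles w"
  shows "simple_path (curve w l)" "pathfinish (curve w l) = pathstart (curve w l)"
proof -
  have l: "smooth_closed_curve (curve w l)" "simple_path (curve w l)"
    using assms embedded by (auto simp: smoothly_embedded_def)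
  then have "\<exists>D. D (0::nat) = curve w l \<and> (\<forall>n. D n 0 = D n 1)"
    unfolding smooth_closed_curve_def by (elim exE conjE) (intro exI conjI)
  then have "curve w l 0 = curve w l 1" by metis
  then show "simple_path (curve w l)" "pathfinish (curve w l) = pathstart (curve w l)"
    using l(2) by (simp_all add: pathstart_def pathfinish_def)
qed

lemma image_arc:
  assumes "e \<in> arcs G"
  shows "path_image (curve w e) = curve_interior w e \<union> {tail G e, head G e}"
proof -
  have "e \<notin> circles w" using assms fin(3) by auto
  have "{0..1::real} = {0<..<1} \<union> {0, 1}" by auto
  then have "path_image (curve w e) = curve w e ` {0<..<1} \<union> {curve w e 0, curve w e 1}"
    unfolding path_image_def by (metis image_Un image_insert image_empty)
  then show ?thesis
    using curve_arc(2,3) [OF assms] \<open>e \<notin> circles w\<close> by (simp add: curve_interior_def pathstart_def pathfinish_def)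
qed

lemma interior_disjoint:
  assumes "e \<in> edges_and_circles w" "f \<in> edges_and_circles w" "e \<noteq> f"
  shows "curve_interior w e \<inter> curve_interior w f = {}"
  using embedded assms by (simp add: smoothly_embedded_def disjoint_family_on_def)

lemma interior_verts: "e \<in> edges_and_circles w \<Longrightarrow> curve_interior w e \<inter> verts G = {}"
  using embedded by (simp add: smoothly_embedded_def)

lemma image_arcs_Int:
  assumes ef: "e \<in> arcs G" "f \<in> arcs G" "e \<noteq> f"
  shows "path_image (curve w e) \<inter> path_image (curve w f) \<subseteq> {tail G e, head G e} \<inter> {tail G f, head G f}"
proof -
  have m: "e \<in> edges_and_circles w" "f \<in> edges_and_circles w" using ef by (auto simp: edges_and_circles_def)
  show ?thesis
    unfolding image_arc [OF ef(1)] image_arc [OF ef(2)]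
    using interior_disjoint [OF m ef(3)] interior_verts [OF m(1)] interior_verts [OF m(2)]
      ends_in_verts [OF ef(1)] ends_in_verts [OF ef(2)]
    by blast
qed

lemma image_circle_Int:
  assumes l: "l \<in> circles w" and e: "e \<in> arcs G \<union> circles w" "e \<noteq> l"
  shows "path_image (curve w l) \<inter> path_image (curve w e) = {}"
proof -
  have m: "e \<in> edges_and_circles w" "l \<in> edges_and_circles w" using l e by (auto simp: edges_and_circles_def)
  have il: "path_image (curve w l) = curve_interior w l" using l by (simp add: curve_interior_def)
  show ?thesis
  proof (cases "e \<in> circles w")
    case True
    then show ?thesis
      using interior_disjoint [OF m(2,1)] e(2) unfolding il by (auto simp: curve_interior_def)
  next
    case False
    then have "e \<in> arcs G" using e(1) by blast
    then show ?thesis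
      unfolding il image_arc [OF \<open>e \<in> arcs G\<close>]
      using interior_disjoint [OF m(2,1)] e(2) interior_verts [OF m(2)] ends_in_verts [of e] by blast
  qed
qed

definition orient :: "'e set \<Rightarrow> 'e \<Rightarrow> real \<Rightarrow> complex" where
  "orient R e = (if e \<in> R then reversepath (curve w e) else curve w e)"

lemma curve_reverse_edges: "curve (reverse_edges R (configuration a w c)) = orient R"
  by (auto simp: reverse_edges_def configuration_def orient_def fun_eq_iff)

lemma arcs_configuration: "arcs (digraph_of (configuration a w c)) = {e \<in> arcs G. c e \<noteq> a}"
  and circles_configuration: "circles (configuration a w c) = {l \<in> circles w. c l \<noteq> a}"
  and other_configuration: "verts (digraph_of (configuration a w c)) = verts G"
    "tail (digraph_of (configuration a w c)) = tail G" "head (digraph_of (configuration a w c)) = head G"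
    "curve (configuration a w c) = curve w"
  by (simp_all add: configuration_def)

lemma path_image_orient [simp]: "path_image (orient R e) = path_image (curve w e)"
  by (simp add: orient_def)

lemma orient_ends:
  assumes "e \<in> arcs G"
  shows "pathstart (orient R e) = (if e \<in> R then head G e else tail G e)"
    "pathfinish (orient R e) = (if e \<in> R then tail G e else head G e)"
  using curve_arc [OF assms] by (auto simp: orient_def)

text \<open>\<open>b\<close> tells whether \<open>v\<close> is a sink. It does not depend on
  \<open>R\<close>, so a single \<open>b\<close> serves all edges at \<open>v\<close> and all
  reversals.\<close>

lemma orient_incident:
  assumes v: "v \<in> verts G"
  obtains b where "\<And>e R. e \<in> incident v \<Longrightarrow> (pathstart (orient R e) = v \<longleftrightarrow> (e \<in> R) = b)"
    "\<And>e R. e \<in> incident v \<Longrightarrow> (pathfinish (orient R e) = v \<longleftrightarrow> (e \<in> R) = (\<not> b))"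
proof -
  have "e \<in> arcs G" if "e \<in> incident v" for e using that by (simp add: incident_def)
  note oe = orient_ends [OF this]
  from source_or_sink [OF v] show ?thesis
  proof
    assume "\<forall>e\<in>incident v. tail G e = v \<and> head G e \<noteq> v"
    then show ?thesis using oe by (intro that [of False]) auto
  next
    assume "\<forall>e\<in>incident v. head G e = v \<and> tail G e \<noteq> v"
    then show ?thesis using oe by (intro that [of True]) auto
  qed
qed

text \<open>At each vertex one edge of each color of \<open>colors_without a\<close> survives. Both
  point the same way in the web; reversing the one with the greater color lets one arrive and the
  other leave.\<close>

lemma oriented_configuration:
  "oriented_configuration (configuration a w c) {e. c e = Max (colors_without a)}"
proof -
  define R where "R = {e. c e = Max (colors_without a)}"
  let ?X = "{e \<in> arcs G. c e \<noteq> a}" and ?Y = "{l \<in> circles w. c l \<noteq> a}"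
  have R_color: "c e = c f" if "(e \<in> R) = (f \<in> R)" "c e \<noteq> a" "c f \<noteq> a" for e f
    using that color_eq_MinI [of "c e" a] color_eq_MinI [of "c f" a] by (auto simp: R_def)
  have colored: "\<exists>e\<in>?X. e \<in> incident v \<and> (e \<in> R) = b" if v: "v \<in> verts G" for v b
  proof -
    obtain e where e: "e \<in> incident v" "c e = (if b then Max (colors_without a) else Min (colors_without a))"
      by (rule incident_color_exists [OF v]) (rule that)
    have "c e \<noteq> a" "(e \<in> R) = b"
      using e(2) Max_colors_without_neq Min_colors_without_neq by (auto simp: R_def)
    then show ?thesis using e(1) by (auto simp: incident_def)
  qed
  have start: "pathstart (orient R e) \<in> verts G" "e \<in> incident (pathstart (orient R e))"
    and finish: "pathfinish (orient R e) \<in> verts G" "e \<in> incident (pathfinish (orient R e))" if "e \<in> arcs G" for e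
    using ends_in_verts [OF that] orient_ends [OF that] that by (auto simp: incident_def)
  have inj_s: "inj_on (\<lambda>e. pathstart (orient R e)) ?X"
  proof (rule inj_onI)
    fix e f assume *: "e \<in> ?X" "f \<in> ?X" "pathstart (orient R e) = pathstart (orient R f)"
    define v where "v = pathstart (orient R e)"
    have v: "v \<in> verts G" "e \<in> incident v" "f \<in> incident v"
      using start [of e] start [of f] * by (auto simp: v_def)
    obtain b where "\<And>e R. e \<in> incident v \<Longrightarrow> (pathstart (orient R e) = v \<longleftrightarrow> (e \<in> R) = b)"
      by (rule orient_incident [OF v(1)]) (rule that)
    then have "(e \<in> R) = b" "(f \<in> R) = b" using v * by (auto simp: v_def)
    then have "c e = c f" using R_color * by auto
    then show "e = f" using inj_onD [OF inj_color_incident] v by blast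
  qed
  have inj_f: "inj_on (\<lambda>e. pathfinish (orient R e)) ?X"
  proof (rule inj_onI)
    fix e f assume *: "e \<in> ?X" "f \<in> ?X" "pathfinish (orient R e) = pathfinish (orient R f)"
    define v where "v = pathfinish (orient R e)"
    have v: "v \<in> verts G" "e \<in> incident v" "f \<in> incident v"
      using finish [of e] finish [of f] * by (auto simp: v_def)
    obtain b where "\<And>e R. e \<in> incident v \<Longrightarrow> (pathfinish (orient R e) = v \<longleftrightarrow> (e \<in> R) = (\<not> b))"
      by (rule orient_incident [OF v(1)]) (rule that)
    then have "(e \<in> R) = (\<not> b)" "(f \<in> R) = (\<not> b)" using v * by (auto simp: v_def)
    then have "c e = c f" using R_color * by auto
    then show "e = f" using inj_onD [OF inj_color_incident] v by blast
  qed
  have im_s: "(\<lambda>e. pathstart (orient R e)) ` ?X = verts G" and im_f: "(\<lambda>e. pathfinish (orient R e)) ` ?X = verts G"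
  proof -
    have "\<exists>e\<in>?X. pathstart (orient R e) = v" "\<exists>e\<in>?X. pathfinish (orient R e) = v" if v: "v \<in> verts G" for v
    proof -
      obtain b where b: "\<And>e R. e \<in> incident v \<Longrightarrow> (pathstart (orient R e) = v \<longleftrightarrow> (e \<in> R) = b)"
        "\<And>e R. e \<in> incident v \<Longrightarrow> (pathfinish (orient R e) = v \<longleftrightarrow> (e \<in> R) = (\<not> b))"
        by (rule orient_incident [OF v]) (rule that)
      show "\<exists>e\<in>?X. pathstart (orient R e) = v" using colored [OF v, of b] b(1) by blast
      show "\<exists>e\<in>?X. pathfinish (orient R e) = v" using colored [OF v, of "\<not> b"] b(2) by blast
    qed
    then show "(\<lambda>e. pathstart (orient R e)) ` ?X = verts G" "(\<lambda>e. pathfinish (orient R e)) ` ?X = verts G"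
      using start(1) finish(1) by (auto simp: image_iff)
  qed
  have "arc_system ?X ?Y (orient R)"
  proof
    show "finite ?X" "finite ?Y" "?X \<inter> ?Y = {}" using fin by auto
    show "arc (orient R e)" if "e \<in> ?X" for e
      using curve_arc(4) [of e] that by (auto simp: orient_def arc_reversepath)
    show "simple_path (orient R l)" "pathfinish (orient R l) = pathstart (orient R l)" if "l \<in> ?Y" for l
      using curve_circle [of l] that by (auto simp: orient_def simple_path_reversepath)
    show "path_image (orient R e) \<inter> path_image (orient R f)
        \<subseteq> {pathstart (orient R e), pathfinish (orient R e)} \<inter> {pathstart (orient R f), pathfinish (orient R f)}"
      if "e \<in> ?X" "f \<in> ?X" "e \<noteq> f" for e f
    proof -
      have ef: "e \<in> arcs G" "f \<in> arcs G" using that by auto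
      have "{pathstart (orient R k), pathfinish (orient R k)} = {tail G k, head G k}" if "k \<in> arcs G" for k
        using orient_ends [OF that, of R] by auto
      then show ?thesis using image_arcs_Int [OF ef that(3)] ef by simp
    qed
    show "path_image (orient R l) \<inter> path_image (orient R e) = {}" if "l \<in> ?Y" "e \<in> ?X \<union> ?Y" "e \<noteq> l" for l e
      using image_circle_Int [of l e] that by auto
  qed (use inj_s inj_f im_s im_f in simp_all)
  then show ?thesis
    unfolding oriented_configuration_def oriented_configuration_axioms_def R_def [symmetric]
      curve_reverse_edges arcs_configuration circles_configuration other_configuration
    using im_s curve_arc(2,3) by simp
qed

end

section \<open>Effect of the exchange on the three degrees\<close>

text \<open>Reversing all of \<open>K\<close> negates its index and hence its sign, and the other
  components keep theirs; the degree drops by twice the old sign. There is one graph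
  \<open>D\<close> with two reversals because the exchange does not change which edges
  survive.\<close>

lemma config_degree_flip_component:
  assumes "oriented_configuration D R" "oriented_configuration D R'"
    and R: "R = {e. c e = Max (colors_without u)}" and R': "R' = {e. c' e = Max (colors_without u)}"
    and K: "K \<in> components (support D)"
    and flip: "\<And>e. e \<in> edges_and_circles D \<Longrightarrow> path_image (curve D e) \<subseteq> K \<Longrightarrow> e \<in> R' \<longleftrightarrow> e \<notin> R"
    and same: "\<And>e. e \<in> edges_and_circles D \<Longrightarrow> \<not> path_image (curve D e) \<subseteq> K \<Longrightarrow> e \<in> R' \<longleftrightarrow> e \<in> R"
  shows "config_degree u c' D = config_degree u c D + (if positively_oriented u c (restrict_to D K) then - 2 else 2)"
proof -
  interpret o: oriented_configuration D R by fact
  interpret o': oriented_configuration D R' by fact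
  let ?comps = "components (support D)"
  have sup: "o.drawing = support D" "o'.drawing = support D"
    using o.support_eq o'.support_eq by simp_all
  have K_o: "K \<in> components o.drawing" using K by (simp add: sup)
  have neg: "winding_number (curve (reverse_edges R' D) e) z = - winding_number (curve (reverse_edges R D) e) z"
    if e: "e \<in> edges_and_circles D" "path_image (curve D e) \<subseteq> K" and z: "z \<in> inside K" for e z
  proof -
    have "z \<notin> path_image (curve D e)" using e(2) z inside_no_overlap by blast
    moreover have "path (curve D e)"
      using o.path_h [of e] e(1) by (auto simp: edges_and_circles_def reverse_edges_def split: if_splits)
    ultimately have "winding_number (reversepath (curve D e)) z = - winding_number (curve D e) z"
      by (intro winding_number_reversepath)
    then show ?thesis using flip [OF e] by (auto simp: reverse_edges_def)
  qed
  have local': "o'.local_sum K' = (if K' = K then - o.local_sum K else o.local_sum K')" if K': "K' \<in> ?comps" for K'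
  proof -
    have K'_o: "K' \<in> components o.drawing" and K'_o': "K' \<in> components o'.drawing" using K' by (simp_all add: sup)
    \<comment> \<open>Both local sums are evaluated at one and the same point, where they become
      sums over single edges.\<close>
    obtain z where z: "z \<in> inside K'" using o.inside_component_nonempty [OF K'_o] by blast
    let ?F = "{e \<in> arcs (digraph_of D) \<union> circles D. path_image (curve D e) \<subseteq> K'}"
    have ix: "o.local_sum K' = (\<Sum>e\<in>?F. winding_number (curve (reverse_edges R D) e) z)"
      "o'.local_sum K' = (\<Sum>e\<in>?F. winding_number (curve (reverse_edges R' D) e) z)"
      using o.local_sum_eq_index [OF K'_o z] o'.local_sum_eq_index [OF K'_o' z]
      by (simp_all add: o.index_def o'.index_def o.im_eq o'.im_eq)
    show ?thesis
    proof (cases "K' = K")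
      case True
      have "o'.local_sum K' = (\<Sum>e\<in>?F. - winding_number (curve (reverse_edges R D) e) z)"
        unfolding ix(2) using neg z True by (intro sum.cong refl) (auto simp: edges_and_circles_def)
      then show ?thesis using True ix(1) by (simp add: sum_negf)
    next
      case False
      have "curve (reverse_edges R' D) e = curve (reverse_edges R D) e" if e: "e \<in> ?F" for e
      proof -
        have "\<not> path_image (curve D e) \<subseteq> K"
          using o.component_unique [OF K_o K'_o, of e] e False by (auto simp: o.im_eq)
        then have "e \<in> R' \<longleftrightarrow> e \<in> R" using same [of e] e by (auto simp: edges_and_circles_def)
        then show ?thesis by (simp add: reverse_edges_def)
      qed
      then have "o'.local_sum K' = o.local_sum K'"
        unfolding ix by (intro sum.cong refl) simp
      then show ?thesis using False by simp
    qed
  qed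
  have fin: "finite ?comps" using o.finite_components by (simp add: sup)
  have "of_int (config_degree u c' D) = (\<Sum>K'\<in>?comps. o'.local_sum K')"
    using o'.config_degree_eq [OF R'] by (simp add: sup)
  also have "\<dots> = o'.local_sum K + (\<Sum>K'\<in>?comps - {K}. o'.local_sum K')"
    using fin K by (rule sum.remove)
  also have "\<dots> = - o.local_sum K + (\<Sum>K'\<in>?comps - {K}. o.local_sum K')"
    using local' K by (intro arg_cong2 [where f = "(+)"] sum.cong) auto
  also have "\<dots> = (\<Sum>K'\<in>?comps. o.local_sum K') - 2 * o.local_sum K"
    using sum.remove [OF fin K, of o.local_sum] by simp
  also have "(\<Sum>K'\<in>?comps. o.local_sum K') = of_int (config_degree u c D)"
    using o.config_degree_eq [OF R] by (simp add: sup)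
  also have "of_int (config_degree u c D) - 2 * o.local_sum K
      = of_int (config_degree u c D + (if positively_oriented u c (restrict_to D K) then - 2 else 2))"
    using o.local_sum_sign [OF R K_o] by simp
  finally show ?thesis by (simp only: of_int_eq_iff)
qed

context colored_web
begin

text \<open>The condition picks the edges colored \<open>u\<close> if \<open>u\<close> is
  \<open>Blue\<close>, and their complement otherwise. It depends on the coloring only through the
  set of edges colored \<open>u\<close>.\<close>

definition transversal :: "color \<Rightarrow> 'e set" where
  "transversal u = {e. (c e = u) = (u = Blue)}"

text \<open>All edges at a vertex point the same way in the web, so if one now arrives and the other
  leaves, exactly one has been reversed. Being reversed is decided by being colored
  \<open>u\<close>.\<close>

lemma follows_transversal:
  assumes ef: "e \<in> arcs G" "f \<in> arcs G"
    and follows: "pathfinish (orient (transversal u) e) = pathstart (orient (transversal u) f)"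
  shows "(c e = u) \<noteq> (c f = u)"
proof -
  let ?R = "transversal u"
  define v where "v = pathfinish (orient ?R e)"
  have v: "v \<in> verts G" "e \<in> incident v" "f \<in> incident v"
    using ef ends_in_verts orient_ends [OF ef(1), of ?R] orient_ends [OF ef(2), of ?R] follows
    by (auto simp: v_def incident_def split: if_splits)
  obtain b where b: "\<And>e R. e \<in> incident v \<Longrightarrow> (pathstart (orient R e) = v \<longleftrightarrow> (e \<in> R) = b)"
    "\<And>e R. e \<in> incident v \<Longrightarrow> (pathfinish (orient R e) = v \<longleftrightarrow> (e \<in> R) = (\<not> b))"
    by (rule orient_incident [OF v(1)]) (rule that)
  have "(e \<in> ?R) = (\<not> b)" using b(2) [OF v(2), of ?R] by (simp add: v_def)
  moreover have "(f \<in> ?R) = b" using b(1) [OF v(3), of ?R] follows by (simp add: v_def)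
  ultimately show ?thesis by (auto simp: transversal_def)
qed

lemma config_degree_transversal:
  assumes "u \<noteq> Green" "a \<noteq> u"
  defines "h \<equiv> orient (transversal u)"
  shows "of_int (config_degree a c (configuration a w c))
    = (\<Sum>l | l \<in> circles w \<and> c l \<noteq> a. loop_sign (h l))
    + (\<Sum>(e, f) | e \<in> arcs G \<and> f \<in> arcs G \<and> pathfinish (h e) = pathstart (h f) \<and> c e \<noteq> a \<and> c f \<noteq> a. turn (h e) (h f))"
proof -
  let ?R = "{e. c e = Max (colors_without a)}"
  interpret oriented_configuration "configuration a w c" ?R
    by (rule oriented_configuration)
  have h: "orient ?R e = h e" if "c e \<noteq> a" for e
  proof -
    \<comment> \<open>Here green is excluded. The two rules need to agree only on the two colors
      that survive the removal of \<open>a\<close>.\<close>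
    have "e \<in> ?R \<longleftrightarrow> e \<in> transversal u"
      using assms(1,2) that by (cases a; cases u; cases "c e") (simp_all add: transversal_def)
    then show ?thesis by (simp add: orient_def h_def)
  qed
  have "of_int (config_degree a c (configuration a w c))
    = (\<Sum>l | l \<in> circles w \<and> c l \<noteq> a. loop_sign (orient ?R l))
    + (\<Sum>(e, f) | e \<in> {e \<in> arcs G. c e \<noteq> a} \<and> f \<in> {e \<in> arcs G. c e \<noteq> a} \<and>
        pathfinish (orient ?R e) = pathstart (orient ?R f). turn (orient ?R e) (orient ?R f))"
    using config_degree_eq [OF refl] sum_local_sum
    unfolding curve_reverse_edges arcs_configuration circles_configuration by simp
  also have "(\<Sum>l | l \<in> circles w \<and> c l \<noteq> a. loop_sign (orient ?R l))
      = (\<Sum>l | l \<in> circles w \<and> c l \<noteq> a. loop_sign (h l))"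
    by (intro sum.cong refl) (simp add: h)
  also have "(\<Sum>(e, f) | e \<in> {e \<in> arcs G. c e \<noteq> a} \<and> f \<in> {e \<in> arcs G. c e \<noteq> a} \<and>
        pathfinish (orient ?R e) = pathstart (orient ?R f). turn (orient ?R e) (orient ?R f))
      = (\<Sum>(e, f) | e \<in> arcs G \<and> f \<in> arcs G \<and> pathfinish (h e) = pathstart (h f) \<and> c e \<noteq> a \<and> c f \<noteq> a. turn (h e) (h f))"
    by (intro sum.cong) (auto simp: h)
  finally show ?thesis .
qed

text \<open>A circle colored \<open>u\<close> survives in both configurations, any other circle in
  one of them. A consecutive pair has the color \<open>u\<close> and one further color, so it
  survives only where the third color is removed.\<close>

lemma sum_config_degree_transversal:
  assumes "u \<noteq> Green"
  defines "h \<equiv> orient (transversal u)"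
  shows "of_int (\<Sum>a\<in>UNIV - {u}. config_degree a c (configuration a w c))
    = (\<Sum>l\<in>circles w. (if c l = u then 2 else 1) * loop_sign (h l))
    + (\<Sum>(e, f) | e \<in> arcs G \<and> f \<in> arcs G \<and> pathfinish (h e) = pathstart (h f). turn (h e) (h f))"
proof -
  define P where "P = {(e, f). e \<in> arcs G \<and> f \<in> arcs G \<and> pathfinish (h e) = pathstart (h f)}"
  define t where "t = (\<lambda>x. turn (h (fst x)) (h (snd x)))"
  have "P \<subseteq> arcs G \<times> arcs G" by (auto simp: P_def)
  then have finP: "finite P" using fin(1) by (meson finite_SigmaI finite_subset)
  have "of_int (\<Sum>a\<in>UNIV - {u}. config_degree a c (configuration a w c))
      = (\<Sum>a\<in>UNIV - {u}. (\<Sum>l | l \<in> circles w \<and> c l \<noteq> a. loop_sign (h l))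
          + (\<Sum>x | x \<in> P \<and> c (fst x) \<noteq> a \<and> c (snd x) \<noteq> a. t x))"
    unfolding of_int_sum
  proof (rule sum.cong [OF refl])
    fix a assume "a \<in> UNIV - {u}"
    moreover have "{(e, f). e \<in> arcs G \<and> f \<in> arcs G \<and> pathfinish (h e) = pathstart (h f) \<and> c e \<noteq> a \<and> c f \<noteq> a}
        = {x. x \<in> P \<and> c (fst x) \<noteq> a \<and> c (snd x) \<noteq> a}"
      by (auto simp: P_def)
    ultimately show "of_int (config_degree a c (configuration a w c))
        = (\<Sum>l | l \<in> circles w \<and> c l \<noteq> a. loop_sign (h l))
        + (\<Sum>x | x \<in> P \<and> c (fst x) \<noteq> a \<and> c (snd x) \<noteq> a. t x)"
      using config_degree_transversal [OF assms(1), of a] by (simp add: h_def [symmetric] t_def case_prod_beta)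
  qed
  also have "\<dots> = (\<Sum>l\<in>circles w. \<Sum>a\<in>UNIV - {u}. if c l \<noteq> a then loop_sign (h l) else 0)
      + (\<Sum>x\<in>P. \<Sum>a\<in>UNIV - {u}. if c (fst x) \<noteq> a \<and> c (snd x) \<noteq> a then t x else 0)"
    unfolding sum.distrib sum.inter_filter [OF fin(2)] sum.inter_filter [OF finP]
    by (intro arg_cong2 [where f = "(+)"] sum.swap)
  also have "(\<Sum>l\<in>circles w. \<Sum>a\<in>UNIV - {u}. if c l \<noteq> a then loop_sign (h l) else 0)
      = (\<Sum>l\<in>circles w. (if c l = u then 2 else 1) * loop_sign (h l))"
  proof (rule sum.cong [OF refl])
    fix l
    show "(\<Sum>a\<in>UNIV - {u}. if c l \<noteq> a then loop_sign (h l) else 0) = (if c l = u then 2 else 1) * loop_sign (h l)"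
      by (cases u; cases "c l") (simp_all add: colors_without_eq)
  qed
  also have "(\<Sum>x\<in>P. \<Sum>a\<in>UNIV - {u}. if c (fst x) \<noteq> a \<and> c (snd x) \<noteq> a then t x else 0) = (\<Sum>x\<in>P. t x)"
  proof (rule sum.cong [OF refl])
    fix x assume "x \<in> P"
    then have "(c (fst x) = u) \<noteq> (c (snd x) = u)"
      using follows_transversal [of "fst x" "snd x" u] by (auto simp: P_def h_def)
    then show "(\<Sum>a\<in>UNIV - {u}. if c (fst x) \<noteq> a \<and> c (snd x) \<noteq> a then t x else 0) = t x"
      by (cases u; cases "c (fst x)"; cases "c (snd x)") (simp_all add: colors_without_eq)
  qed
  finally show ?thesis by (simp add: P_def t_def case_prod_beta)
qed

end

lemma transpose_color:
  "Transposition.transpose (Min (colors_without u)) (Max (colors_without u)) x = u \<longleftrightarrow> x = u"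
  "x \<noteq> u \<Longrightarrow> Transposition.transpose (Min (colors_without u)) (Max (colors_without u)) x = Max (colors_without u)
    \<longleftrightarrow> x \<noteq> Max (colors_without u)"
  by (cases u; cases x; simp add: Transposition.transpose_def)+

theorem proposition2p3:
  fixes w :: "'e plane_graph" and c :: "'e \<Rightarrow> color" and u :: color and C :: "'e plane_graph"
  assumes "closed_web w"
    and "coloring w c"
    and "u \<noteq> Green"
    and "C \<in> bicolored_cycles u w c"
  shows "(positively_oriented u c C \<longrightarrow>
            total_degree w (swap_colors u C c) = total_degree w c - 2) \<and>
         (negatively_oriented u c C \<longrightarrow>
            total_degree w (swap_colors u C c) = total_degree w c + 2)"
proof -
  let ?t = "Transposition.transpose (Min (colors_without u)) (Max (colors_without u))"
  define c' where "c' = swap_colors u C c"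
  define D where "D = configuration u w c"
  interpret colored_web w c using assms by unfold_locales
  obtain K where K: "K \<in> components (support D)" and C: "C = restrict_to D K"
    using assms(4) by (auto simp: bicolored_cycles_def component_graphs_def D_def)
  have c'_eq: "c' e = (if e \<in> edges_and_circles C then ?t (c e) else c e)" for e
    by (simp add: c'_def swap_colors_def)
  have mem_C: "e \<in> edges_and_circles C \<longleftrightarrow> e \<in> edges_and_circles D \<and> path_image (curve D e) \<subseteq> K" for e
    by (auto simp: C edges_and_circles_def restrict_to_def)
  have mem_D: "e \<in> edges_and_circles D \<longleftrightarrow> e \<in> edges_and_circles w \<and> c e \<noteq> u" for e
    by (auto simp: D_def edges_and_circles_def configuration_def)
  have c'_u: "c' e = u \<longleftrightarrow> c e = u" for e
    unfolding c'_eq using transpose_color(1) by simp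
  \<comment> \<open>The color \<open>u\<close> is not touched, so the third configuration is the
    same plane graph before and after; only the set of its reversed edges differs.\<close>
  have D': "configuration u w c' = D"
    by (simp add: D_def configuration_def c'_u)
  \<comment> \<open>Adjacent edges not colored \<open>u\<close> share a vertex and hence a component
    of \<open>D\<close>. So the two colors are exchanged on both or on neither, and the new coloring
    is proper.\<close>
  have connected_pair: "f \<in> edges_and_circles C"
    if adj: "adjacent_edges w e f" and e: "e \<in> edges_and_circles C" and f: "c f \<noteq> u" for e f
  proof -
    have ef: "e \<in> arcs G" "f \<in> arcs G" using adj by (auto simp: adjacent_edges_def)
    obtain v where v: "v \<in> {tail G e, head G e}" "v \<in> {tail G f, head G f}"
      using adj by (auto simp: adjacent_edges_def)
    have fD: "f \<in> edges_and_circles D" using f ef(2) unfolding mem_D by (simp add: edges_and_circles_def)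
    have cD: "curve D = curve w" by (simp add: D_def configuration_def)
    have "v \<in> path_image (curve D e)" "v \<in> path_image (curve D f)"
      using v image_arc [OF ef(1)] image_arc [OF ef(2)] by (auto simp: cD)
    then have "K \<inter> path_image (curve D f) \<noteq> {}" using e unfolding mem_C by auto
    moreover have "path_image (curve D f) \<subseteq> support D" using fD by (auto simp: support_def)
    moreover have "topological_space_class.connected (path_image (curve D f))"
      using curve_arc(1) [OF ef(2)] by (simp add: cD connected_simple_path_image)
    ultimately have "path_image (curve D f) \<subseteq> K"
      using components_maximal [OF K] by blast
    then show ?thesis using fD by (simp add: mem_C)
  qed
  have "coloring w c'"
    unfolding coloring_def
  proof (intro allI impI)
    fix e f assume adj: "adjacent_edges w e f"
    then have adj': "adjacent_edges w f e" by (auto simp: adjacent_edges_def)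
    have ne: "c e \<noteq> c f" using adj assms(2) by (simp add: coloring_def)
    show "c' e \<noteq> c' f"
    proof (cases "c e = u \<or> c f = u")
      case True
      then show ?thesis using c'_u ne by metis
    next
      case False
      then have "e \<in> edges_and_circles C \<longleftrightarrow> f \<in> edges_and_circles C"
        using connected_pair [OF adj] connected_pair [OF adj'] by blast
      moreover have "?t (c e) \<noteq> ?t (c f)"
        using ne by (metis Transposition.transpose_involutory)
      ultimately show ?thesis using ne by (simp add: c'_eq)
    qed
  qed
  then interpret c': colored_web w c' using assms(1) by unfold_locales
  have "config_degree u c' D = config_degree u c D + (if positively_oriented u c C then - 2 else 2)"
    unfolding C
  proof (rule config_degree_flip_component [OF _ _ refl refl K])
    show "oriented_configuration D {e. c e = Max (colors_without u)}"
      using oriented_configuration by (simp add: D_def)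
    show "oriented_configuration D {e. c' e = Max (colors_without u)}"
      using c'.oriented_configuration [of u] by (simp add: D')
    fix e assume e: "e \<in> edges_and_circles D"
    then have "c e \<noteq> u" by (simp add: mem_D)
    show "e \<in> {e. c' e = Max (colors_without u)} \<longleftrightarrow> e \<notin> {e. c e = Max (colors_without u)}"
      if "path_image (curve D e) \<subseteq> K"
      using e that transpose_color(2) [OF \<open>c e \<noteq> u\<close>] by (simp add: c'_eq mem_C)
    show "e \<in> {e. c' e = Max (colors_without u)} \<longleftrightarrow> e \<in> {e. c e = Max (colors_without u)}"
      if "\<not> path_image (curve D e) \<subseteq> K"
      using that by (simp add: c'_eq mem_C)
  qed
  \<comment> \<open>The local formula sees the coloring only through the set of edges and circles
    colored \<open>u\<close>. An identity of complex numbers results, from which that of the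
    integers is read off.\<close>
  moreover have "(\<Sum>a\<in>UNIV - {u}. config_degree a c' (configuration a w c'))
      = (\<Sum>a\<in>UNIV - {u}. config_degree a c (configuration a w c))"
  proof -
    have "c'.transversal u = transversal u" by (simp add: transversal_def c'.transversal_def c'_u)
    then have "of_int (\<Sum>a\<in>UNIV - {u}. config_degree a c' (configuration a w c'))
        = (of_int (\<Sum>a\<in>UNIV - {u}. config_degree a c (configuration a w c)) :: complex)"
      unfolding sum_config_degree_transversal [OF assms(3)] c'.sum_config_degree_transversal [OF assms(3)]
      by (simp add: c'_u)
    then show ?thesis by (simp only: of_int_eq_iff)
  qed
  moreover have "total_degree w d = config_degree u d (configuration u w d)
      + (\<Sum>a\<in>UNIV - {u}. config_degree a d (configuration a w d))" for d
    unfolding total_degree_def by (rule sum.remove) auto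
  ultimately have "total_degree w c' = total_degree w c + (if positively_oriented u c C then - 2 else 2)"
    by (simp add: D' D_def)
  then show ?thesis by (simp add: c'_def negatively_oriented_def)
qed

end
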